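(* Let $K$ be a field, let $S=K[t_1,\ldots,t_s]$, $s\geq 2$, be a polynomial ring with the standard grading, let $\mathbb{X}$ be a finite subset of the projective space $\mathbb{P}^{s-1}$ over $K$ with vanishing ideal $I(\mathbb{X})\subset S$, and let $\prec$ be a graded monomial order on $S$ such that ${\rm in}_\prec(I(\mathbb{X}))$ is a complete intersection generated by monomials $t^{\alpha_2},\ldots,t^{\alpha_s}$, with $d_i=\deg(t^{\alpha_i})$ and $1\leq d_i\leq d_{i+1}$ for all $i$. If hyperplanes $H_1,\ldots,H_d$ in $\mathbb{P}^{s-1}$ avoid a point $[P]$ in $\mathbb{X}$ but otherwise cover all the other $|\mathbb{X}|-1$ points of $\mathbb{X}$ (that is, $[P]\notin H_1\cup\cdots\cup H_d$ and $\mathbb{X}\setminus\{[P]\}\subset H_1\cup\cdots\cup H_d$), then $$ d\geq {\rm reg}(S/I(\mathbb{X}))=\sum_{i=2}^s(d_i-1). $$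
   Context: The vanishing ideal $I(\mathbb{X})$ is the ideal of $S$ generated by the homogeneous polynomials that vanish at all points of $\mathbb{X}$. An ideal $J\subset S$ is a complete intersection if it can be generated by $r$ elements, where $r$ is the height of $J$. A graded monomial order is one that compares monomials first by total degree. For a graded ideal $J$ of $S$, the regularity ${\rm reg}(S/J)$ is the regularity of the Hilbert function: the least integer $r\geq 0$ such that $H_J(d)=h_J(d)$ for all $d\geq r$, where $H_J(d)=\dim_K(S_d/J_d)$ and $h_J$ is the Hilbert polynomial of $S/J$. *)

theory Defs
  imports
    "HOL-Analysis.Finite_Cartesian_Product"
    "HOL-Computational_Algebra.Polynomial"
    "HOL-Library.Poly_Mapping"
    "HOL-Library.Extended_Nat"
begin

text \<open>
  The polynomial ring in \<open>s\<close> variables over a field \<open>'k\<close>: the variables are indexed by the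
  finite type \<open>'n\<close> with \<open>s = CARD('n)\<close>.  A monomial is identified with its exponent vector,
  so multiplication of monomials is addition of exponents.
\<close>

type_synonym 'n monom = "'n \<Rightarrow>\<^sub>0 nat"
type_synonym ('n, 'k) mpoly = "('n \<Rightarrow>\<^sub>0 nat) \<Rightarrow>\<^sub>0 'k"

definition monom_deg :: "('n::finite) monom \<Rightarrow> nat" where
  "monom_deg a = (\<Sum>i\<in>UNIV. Poly_Mapping.lookup a i)"

definition homogeneous :: "nat \<Rightarrow> ('n::finite, 'k::field) mpoly \<Rightarrow> bool" where
  "homogeneous d f \<longleftrightarrow> (\<forall>a\<in>Poly_Mapping.keys f. monom_deg a = d)"

definition mpoly_eval :: "('n::finite, 'k::field) mpoly \<Rightarrow> 'k ^ 'n \<Rightarrow> 'k" where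
  "mpoly_eval f v =
     (\<Sum>a\<in>Poly_Mapping.keys f. Poly_Mapping.lookup f a *
       (\<Prod>i\<in>UNIV. (v $ i) ^ Poly_Mapping.lookup a i))"

text \<open>
  A commutative ring is a module over itself; its submodules are the ideals, so
  \<^term>\<open>module.subspace (*)\<close> and \<^term>\<open>module.span (*)\<close> (below \<open>ideal.subspace\<close> and
  \<open>ideal.span\<close>) are "is an ideal" and "the ideal generated by".
\<close>

global_interpretation ideal: module "(*) :: 'a::comm_ring_1 \<Rightarrow> 'a \<Rightarrow> 'a"
  by unfold_locales (simp_all add: algebra_simps)

definition prime_ideal :: "'a::comm_ring_1 set \<Rightarrow> bool" where
  "prime_ideal P \<longleftrightarrow> ideal.subspace P \<and> P \<noteq> UNIV \<and> (\<forall>x y. x * y \<in> P \<longrightarrow> x \<in> P \<or> y \<in> P)"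

definition prime_height :: "'a::comm_ring_1 set \<Rightarrow> enat" where
  "prime_height P = Sup {enat n | n. \<exists>c :: nat \<Rightarrow> 'a set.
     (\<forall>i\<le>n. prime_ideal (c i)) \<and> (\<forall>i<n. c i \<subset> c (Suc i)) \<and> c n = P}"

text \<open>The unit ideal has height \<open>\<infinity>\<close> and is therefore not a complete intersection.\<close>

definition ideal_height :: "'a::comm_ring_1 set \<Rightarrow> enat" where
  "ideal_height J = (INF P\<in>{P. prime_ideal P \<and> J \<subseteq> P}. prime_height P)"

definition complete_intersection :: "'a::comm_ring_1 set \<Rightarrow> bool" where
  "complete_intersection J \<longleftrightarrow>
     (\<exists>F. finite F \<and> enat (card F) = ideal_height J \<and> J = ideal.span F)"

text \<open>A relation \<open>r\<close> encodes the order by \<open>(a, b) \<in> r\<close> iff \<open>a \<preceq> b\<close>.\<close>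

definition monomial_order :: "(('n::finite) monom \<times> 'n monom) set \<Rightarrow> bool" where
  "monomial_order r \<longleftrightarrow> well_order_on UNIV r \<and> (\<forall>a b c. (a, b) \<in> r \<longrightarrow> (a + c, b + c) \<in> r)"

definition graded_monomial_order :: "(('n::finite) monom \<times> 'n monom) set \<Rightarrow> bool" where
  "graded_monomial_order r \<longleftrightarrow>
     monomial_order r \<and> (\<forall>a b. monom_deg a < monom_deg b \<longrightarrow> (a, b) \<in> r)"

definition lead_monom :: "('n monom \<times> 'n monom) set \<Rightarrow> ('n::finite, 'k::field) mpoly \<Rightarrow> 'n monom" where
  "lead_monom r f =
     (THE a. a \<in> Poly_Mapping.keys f \<and> (\<forall>b\<in>Poly_Mapping.keys f. (b, a) \<in> r))"

definition initial_ideal ::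
    "('n monom \<times> 'n monom) set \<Rightarrow> ('n::finite, 'k::field) mpoly set \<Rightarrow> ('n, 'k) mpoly set" where
  "initial_ideal r J = ideal.span {Poly_Mapping.single (lead_monom r f) 1 | f. f \<in> J \<and> f \<noteq> 0}"

text \<open>
  The classes of the elements of \<open>B\<close> form a basis of the \<open>'k\<close>-vector space \<open>V / W\<close>; uniqueness of
  the coefficients also forces the classes to be pairwise distinct.  Multiplication by the
  constant polynomial \<open>Poly_Mapping.single 0 c\<close> is scalar multiplication by \<open>c\<close>.
\<close>

definition quotient_basis ::
    "('n::finite, 'k::field) mpoly set \<Rightarrow> ('n, 'k) mpoly set \<Rightarrow> ('n, 'k) mpoly set \<Rightarrow> bool" where
  "quotient_basis V W B \<longleftrightarrow> finite B \<and> B \<subseteq> V \<and>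
     (\<forall>f\<in>V. \<exists>!c :: ('n, 'k) mpoly \<Rightarrow> 'k. (\<forall>b. b \<notin> B \<longrightarrow> c b = 0) \<and>
        f - (\<Sum>b\<in>B. Poly_Mapping.single 0 (c b) * b) \<in> W)"

text \<open>Only meaningful if \<open>V / W\<close> is finite-dimensional, as it is for the pieces used below.\<close>

definition quotient_dim :: "('n::finite, 'k::field) mpoly set \<Rightarrow> ('n, 'k) mpoly set \<Rightarrow> nat" where
  "quotient_dim V W = card (SOME B. quotient_basis V W B)"

definition hilbert_fun :: "('n::finite, 'k::field) mpoly set \<Rightarrow> nat \<Rightarrow> nat" where
  "hilbert_fun J d = quotient_dim {f. homogeneous d f} {f \<in> J. homogeneous d f}"

definition hilbert_poly :: "('n::finite, 'k::field) mpoly set \<Rightarrow> rat poly" where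
  "hilbert_poly J = (THE h. \<exists>N. \<forall>d\<ge>N. of_nat (hilbert_fun J d) = poly h (of_nat d))"

definition regularity :: "('n::finite, 'k::field) mpoly set \<Rightarrow> nat" where
  "regularity J =
     (LEAST r. \<forall>d\<ge>r. of_nat (hilbert_fun J d) = poly (hilbert_poly J) (of_nat d))"

text \<open>A point of projective space is the set of all its (nonzero) representatives.\<close>

definition proj_rel :: "((('k::field) ^ ('n::finite)) \<times> ('k ^ 'n)) set" where
  "proj_rel = {(v, w). v \<noteq> 0 \<and> w \<noteq> 0 \<and> (\<exists>c. c \<noteq> 0 \<and> w = c *s v)}"

definition proj_space :: "(('k::field) ^ ('n::finite)) set set" where
  "proj_space = (UNIV - {0}) // proj_rel"

definition hyperplane :: "(('k::field) ^ ('n::finite)) set set \<Rightarrow> bool" where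
  "hyperplane H \<longleftrightarrow>
     (\<exists>a. a \<noteq> 0 \<and> H = {p \<in> proj_space. \<forall>v\<in>p. (\<Sum>i\<in>UNIV. a $ i * v $ i) = 0})"

definition vanishing_ideal :: "(('k::field) ^ ('n::finite)) set set \<Rightarrow> ('n, 'k) mpoly set" where
  "vanishing_ideal X = ideal.span
     {f. (\<exists>d. homogeneous d f) \<and> (\<forall>p\<in>X. \<forall>v\<in>p. mpoly_eval f v = 0)}"

end

(*
  Let M be the generators of the initial ideal. The monomials outside the initial ideal form bases
  of the graded pieces of S/I(X), and they are linearly independent as functions on X, so there are
  at most |X| of them in each degree. This bound forces the s - 1 generators to involve pairwise
  disjoint sets of variables; counting the standard monomials then gives the regularity.

  For the hyperplanes, multiply their equations to get a form of degree d that vanishes on X except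
  at P, and reduce it to one with standard leading monomial t^a. If d < sum (d_i - 1), then two
  different variables x, y keep t^a x and t^a y standard. A nonzero combination of x and y vanishes
  at P; its product with the form lies in I(X) but has a standard leading monomial.
*)

theory Submission
  imports Defs
begin

section \<open>Multivariate polynomials and evaluation\<close>

text \<open>The shape of the generators is the obstacle. Disjoint supports of s - 1 monomials in s
  variables leave one variable over, which may join the support of a single generator; the others
  are pure powers. If that generator is x_p^u x_q^v with u, v > 0, multiplication by neither x_p nor
  x_q preserves standard monomials, and a linear form avoiding all points of X need not exist over a
  finite field. The count therefore multiplies by x_p or x_q depending on the monomial; sum (d_i -
  1) is the largest degree of a standard monomial that does not arise in this way. The same number
  bounds the separator for another reason. Suppose that multiplying a standard t^a by a variable
  makes it nonstandard. Then some generator divides the product and lacks exactly that one factor in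
  t^a, so different variables need different generators. If all s - 1 generators were used up, t^a
  would contain all but one factor of each, on disjoint supports, and have degree at least sum (d_i
  - 1). Below this degree at least two of the s variables remain.\<close>

abbreviation "lookup \<equiv> Poly_Mapping.lookup"
abbreviation "keys \<equiv> Poly_Mapping.keys"
abbreviation "single \<equiv> Poly_Mapping.single"

lemma poly_mapping_sum_single: "f = (\<Sum>a\<in>keys f. single a (lookup f a))"
  by (rule poly_mapping_eqI) (auto simp: lookup_sum lookup_single when_def in_keys_iff)

lemma keys_diff_subset: "keys (f - g) \<subseteq> keys f \<union> keys (g :: 'a \<Rightarrow>\<^sub>0 'b::ab_group_add)"
  by (auto simp: in_keys_iff lookup_minus)

lemma lookup_single_mult_add:
  fixes f :: "'a::cancel_comm_monoid_add \<Rightarrow>\<^sub>0 'b::comm_ring_1"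
  shows "lookup (single a c * f) (a + b) = c * lookup f b"
proof -
  have "lookup (single a c * f) (a + b) =
      (\<Sum>e\<in>keys f. lookup (single (a + e) (c * lookup f e)) (a + b))"
    by (subst poly_mapping_sum_single[of f])
       (simp add: sum_distrib_left mult_single lookup_sum)
  also have "\<dots> = (\<Sum>e\<in>keys f. if e = b then c * lookup f e else 0)"
    by (intro sum.cong) (auto simp: lookup_single when_def)
  also have "\<dots> = c * lookup f b"
    by (simp add: in_keys_iff)
  finally show ?thesis .
qed

lemma lookup_scalar_mult:
  fixes f :: "'a::cancel_comm_monoid_add \<Rightarrow>\<^sub>0 'b::comm_ring_1"
  shows "lookup (single 0 c * f) b = c * lookup f b"
  using lookup_single_mult_add[of 0 c f b] by simp

lemma monom_deg_add [simp]: "monom_deg (a + b) = monom_deg a + monom_deg b"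
  by (simp add: monom_deg_def lookup_add sum.distrib)

lemma monom_deg_single [simp]: "monom_deg (single i n) = n"
  by (simp add: monom_deg_def lookup_single when_def)

lemma monom_deg_zero [simp]: "monom_deg 0 = 0"
  by (simp add: monom_deg_def)

lemma finite_monom_deg: "finite {a :: ('n::finite) monom. monom_deg a = d}"
proof (rule finite_imageD)
  have le: "lookup a i \<le> monom_deg a" for a :: "'n monom" and i
    unfolding monom_deg_def by (rule member_le_sum) auto
  have "finite (PiE UNIV (\<lambda>_::'n. {..d}))"
    by (intro finite_PiE) auto
  then show "finite (lookup ` {a :: 'n monom. monom_deg a = d})"
    by (rule finite_subset[rotated]) (use le in \<open>auto simp: PiE_UNIV_domain\<close>)
  show "inj_on lookup {a :: 'n monom. monom_deg a = d}"
    by (simp add: inj_on_def lookup_inject)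
qed

lemma homogeneous_zero [simp]: "homogeneous d 0"
  by (simp add: homogeneous_def)

lemma homogeneous_one [simp]: "homogeneous 0 1"
  by (simp add: homogeneous_def)

lemma homogeneous_add: "homogeneous d f \<Longrightarrow> homogeneous d g \<Longrightarrow> homogeneous d (f + g)"
  using Poly_Mapping.keys_add[of f g] by (auto simp: homogeneous_def)

lemma homogeneous_diff: "homogeneous d f \<Longrightarrow> homogeneous d g \<Longrightarrow> homogeneous d (f - g)"
  using keys_diff_subset[of f g] by (auto simp: homogeneous_def)

lemma homogeneous_mult: "homogeneous d f \<Longrightarrow> homogeneous e g \<Longrightarrow> homogeneous (d + e) (f * g)"
  using keys_mult[of f g] by (fastforce simp: homogeneous_def)

lemma homogeneous_single: "monom_deg a = d \<Longrightarrow> homogeneous d (single a c)"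
  by (auto simp: homogeneous_def split: if_splits)

lemma homogeneous_scale: "homogeneous d f \<Longrightarrow> homogeneous d (single 0 c * f)"
  using homogeneous_mult[OF homogeneous_single[of 0 0 c], of d f] by simp

lemma homogeneous_sum: "(\<And>i. i \<in> A \<Longrightarrow> homogeneous d (f i)) \<Longrightarrow> homogeneous d (sum f A)"
  by (induction A rule: infinite_finite_induct) (auto intro: homogeneous_add)

text \<open>A common frame for the two evaluations below: at a point, with values in the field, and
  along a line, with values in the univariate polynomials.\<close>

locale coeff_monom_hom =
  fixes \<phi> :: "'k::comm_ring_1 \<Rightarrow> 'r::comm_ring_1" and \<psi> :: "'a::cancel_comm_monoid_add \<Rightarrow> 'r"
  assumes coeff_add: "\<phi> (c + d) = \<phi> c + \<phi> d" and coeff_mult: "\<phi> (c * d) = \<phi> c * \<phi> d"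
    and monom_add: "\<psi> (a + b) = \<psi> a * \<psi> b"
begin

definition extend :: "('a \<Rightarrow>\<^sub>0 'k) \<Rightarrow> 'r" where
  "extend f = (\<Sum>a\<in>keys f. \<phi> (lookup f a) * \<psi> a)"

lemma coeff_zero: "\<phi> 0 = 0"
  using coeff_add[of 0 0] by simp

lemma extend_superset:
  "finite A \<Longrightarrow> keys f \<subseteq> A \<Longrightarrow> extend f = (\<Sum>a\<in>A. \<phi> (lookup f a) * \<psi> a)"
  unfolding extend_def by (rule sum.mono_neutral_left) (auto simp: in_keys_iff coeff_zero)

lemma extend_zero: "extend 0 = 0"
  by (simp add: extend_def)

lemma extend_single: "extend (single a c) = \<phi> c * \<psi> a"
  by (simp add: extend_def coeff_zero)

lemma extend_add: "extend (f + g) = extend f + extend g"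
proof -
  have "finite (keys f \<union> keys g)" by simp
  note * = extend_superset[OF this]
  show ?thesis
    using Poly_Mapping.keys_add[of f g]
    by (simp add: * lookup_add coeff_add ring_distribs sum.distrib)
qed

lemma extend_diff: "extend (f - g) = extend f - extend g"
  using extend_add[of "f - g" g] by simp

lemma extend_sum: "extend (sum f A) = (\<Sum>i\<in>A. extend (f i))"
  by (induction A rule: infinite_finite_induct) (auto simp: extend_zero extend_add)

lemma extend_mult: "extend (f * g) = extend f * extend g"
proof -
  have "f * g = (\<Sum>a\<in>keys f. single a (lookup f a)) * (\<Sum>b\<in>keys g. single b (lookup g b))"
    by (rule arg_cong2[where f = "(*)", OF poly_mapping_sum_single poly_mapping_sum_single])
  also have "\<dots> = (\<Sum>a\<in>keys f. \<Sum>b\<in>keys g. single (a + b) (lookup f a * lookup g b))"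
    by (simp only: sum_product mult_single)
  finally have *: "f * g = \<dots>" .
  have "extend (f * g) =
      (\<Sum>a\<in>keys f. \<Sum>b\<in>keys g. \<phi> (lookup f a * lookup g b) * \<psi> (a + b))"
    unfolding * by (simp only: extend_sum extend_single)
  also have "\<dots> = extend f * extend g"
    by (simp only: extend_def sum_product coeff_mult monom_add mult_ac)
  finally show ?thesis .
qed

end

definition monom_eval :: "'k::field ^ 'n \<Rightarrow> ('n::finite) monom \<Rightarrow> 'k" where
  "monom_eval v a = (\<Prod>i\<in>UNIV. (v $ i) ^ lookup a i)"

lemma monom_eval_add: "monom_eval v (a + b) = monom_eval v a * monom_eval v b"
  by (simp add: monom_eval_def lookup_add power_add prod.distrib)

lemma monom_eval_scale: "monom_eval (c *s v) a = c ^ monom_deg a * monom_eval v a"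
  by (simp add: monom_eval_def monom_deg_def power_mult_distrib prod.distrib power_sum)

interpretation eval: coeff_monom_hom "\<lambda>c. c" "monom_eval v" for v :: "'k::field ^ 'n::finite"
  by unfold_locales (simp_all add: monom_eval_add)

lemma mpoly_eval_eq: "mpoly_eval f v = eval.extend v f"
  by (simp add: mpoly_eval_def eval.extend_def monom_eval_def)

text \<open>
  Evaluation along the line through \<open>v\<close>: the coefficient of \<open>T ^ d\<close> is the value at \<open>v\<close> of the
  degree \<open>d\<close> component.  This separates the components also over finite fields.
\<close>

interpretation line: coeff_monom_hom "\<lambda>c. [:c:]" "\<lambda>a. monom (monom_eval v a) (monom_deg a)"
  for v :: "'k::field ^ 'n::finite"
  by unfold_locales (simp_all add: monom_eval_add mult_monom)

lemma line_homogeneous: "homogeneous d f \<Longrightarrow> line.extend v f = monom (mpoly_eval f v) d"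
  by (simp add: line.extend_def mpoly_eval_eq eval.extend_def homogeneous_def smult_monom monom_sum)

lemma coeff_line: "coeff (line.extend v f) d =
    (\<Sum>a\<in>{a\<in>keys f. monom_deg a = d}. lookup f a * monom_eval v a)"
proof -
  have "coeff (line.extend v f) d =
      (\<Sum>a\<in>keys f. if monom_deg a = d then lookup f a * monom_eval v a else 0)"
    by (auto simp: line.extend_def coeff_sum smult_monom intro!: sum.cong)
  then show ?thesis
    by (simp add: sum.inter_filter)
qed

lemma mpoly_eval_scale:
  assumes "homogeneous d f"
  shows "mpoly_eval f (c *s v) = c ^ d * mpoly_eval f v"
proof -
  have "lookup f a * monom_eval (c *s v) a = c ^ d * (lookup f a * monom_eval v a)"
    if "a \<in> keys f" for a
    using assms that by (simp add: homogeneous_def monom_eval_scale)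
  then have "(\<Sum>a\<in>keys f. lookup f a * monom_eval (c *s v) a)
      = (\<Sum>a\<in>keys f. c ^ d * (lookup f a * monom_eval v a))"
    by (rule sum.cong[OF refl])
  then show ?thesis
    by (simp only: mpoly_eval_eq eval.extend_def sum_distrib_left)
qed

text \<open>When \<open>line.extend v f\<close> is zero, every homogeneous component of
  \<open>f\<close> vanishes at \<open>v\<close>; this is how the vanishing ideal is seen to be
  graded.\<close>

lemma homogeneous_component:
  obtains g where "homogeneous d g" "\<And>v. mpoly_eval g v = coeff (line.extend v f) d"
    "\<And>a. lookup g a = (if monom_deg a = d then lookup f a else 0)"
proof -
  define g where "g = (\<Sum>a\<in>{a\<in>keys f. monom_deg a = d}. single a (lookup f a))"
  have l: "lookup g a = (if monom_deg a = d then lookup f a else 0)" for a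
    by (auto simp: g_def lookup_sum lookup_single when_def in_keys_iff)
  have k: "keys g = {a\<in>keys f. monom_deg a = d}"
    by (auto simp: in_keys_iff l split: if_splits)
  show ?thesis
    by (rule that[of g]) (auto simp: l homogeneous_def k coeff_line mpoly_eval_eq eval.extend_def)
qed

section \<open>Dimension of quotients\<close>

text \<open>Gaussian elimination: a pivot \<open>p\<close> clears the equation \<open>x\<close>, and
  the induction continues with the modified matrix. It serves both the invariance of dimension and
  the bound by the number of points.\<close>

lemma nontrivial_dependency:
  fixes M :: "'a \<Rightarrow> 'b \<Rightarrow> 'k::field"
  assumes "finite X" "finite A" "card X < card A"
  shows "\<exists>c. (\<exists>a\<in>A. c a \<noteq> 0) \<and> (\<forall>x\<in>X. (\<Sum>a\<in>A. c a * M a x) = 0)"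
  using assms
proof (induction X arbitrary: A M rule: finite_induct)
  case empty
  then obtain a where "a \<in> A"
    by fastforce
  then show ?case
    by (intro exI[of _ "\<lambda>_. 1"]) auto
next
  case (insert x X)
  show ?case
  proof (cases "\<forall>a\<in>A. M a x = 0")
    case True
    then show ?thesis
      using insert.IH[of A M] insert.prems insert.hyps by auto
  next
    case False
    then obtain p where p: "p \<in> A" "M p x \<noteq> 0"
      by auto
    define M' where "M' a y = M a y - M a x / M p x * M p y" for a y
    have "finite (A - {p})" "card X < card (A - {p})"
      using insert.prems insert.hyps p by auto
    from insert.IH[OF this, of M'] obtain c
      where c: "\<exists>a\<in>A - {p}. c a \<noteq> 0" "\<forall>y\<in>X. (\<Sum>a\<in>A - {p}. c a * M' a y) = 0"
      by blast
    define t where "t = (\<Sum>a\<in>A - {p}. c a * M a x) / M p x"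
    define c' where "c' = c(p := - t)"
    have sum: "(\<Sum>a\<in>A. c' a * M a y) = (\<Sum>a\<in>A - {p}. c a * M a y) - t * M p y" for y
      using insert.prems(1) p(1) by (subst sum.remove[of A p]) (auto simp: c'_def)
    have "(\<Sum>a\<in>A. c' a * M a y) = 0" if "y \<in> insert x X" for y
    proof (cases "y = x")
      case True
      then show ?thesis
        unfolding sum t_def using p by simp
    next
      case False
      have "t * M p y = (\<Sum>a\<in>A - {p}. c a * M a x / M p x * M p y)"
        by (simp only: t_def sum_divide_distrib sum_distrib_right)
      then have "(\<Sum>a\<in>A - {p}. c a * M a y) - t * M p y
          = (\<Sum>a\<in>A - {p}. c a * M a y - c a * M a x / M p x * M p y)"
        by (simp only: sum_subtractf)
      also have "\<dots> = (\<Sum>a\<in>A - {p}. c a * M' a y)"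
        by (intro sum.cong) (simp_all add: M'_def right_diff_distrib)
      finally have "(\<Sum>a\<in>A - {p}. c a * M a y) - t * M p y = (\<Sum>a\<in>A - {p}. c a * M' a y)" .
      then show ?thesis
        unfolding sum using c(2) that False by auto
    qed
    moreover have "\<exists>a\<in>A. c' a \<noteq> 0"
      using c(1) by (auto simp: c'_def)
    ultimately show ?thesis
      by blast
  qed
qed

lemma ex1_implies_eq: "P x \<Longrightarrow> P y \<Longrightarrow> \<exists>!z. P z \<Longrightarrow> x = y"
  by blast

text \<open>Since \<open>quotient_dim\<close> takes the size of an arbitrary basis, all bases must
  be compared. If \<open>B\<close> were larger, a dependency among the coordinates of its elements
  with respect to \<open>C\<close> would give a nontrivial combination of \<open>B\<close> in
  \<open>W\<close>, against the uniqueness of the coordinates of 0. A graded piece \<open>W\<close>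
  is not an ideal, so its closure properties come from the ideal \<open>W'\<close>.\<close>

lemma quotient_basis_card_le:
  assumes W: "ideal.subspace W'" "W = W' \<inter> V"
    and VV: "\<And>c b. b \<in> V \<Longrightarrow> single 0 c * b \<in> V" "\<And>f g. f \<in> V \<Longrightarrow> g \<in> V \<Longrightarrow> f + g \<in> V" "0 \<in> V"
    and B: "quotient_basis V W B" and C: "quotient_basis V W C"
  shows "card B \<le> card (C :: ('n::finite, 'k::field) mpoly set)"
proof (rule ccontr)
  assume "\<not> ?thesis"
  then have lt: "card C < card B"
    by simp
  have fin: "finite B" "finite C" and BV: "B \<subseteq> V"
    using B C by (auto simp: quotient_basis_def)
  have Vsum: "(\<And>i. i \<in> A \<Longrightarrow> h i \<in> V) \<Longrightarrow> sum h A \<in> V" for A and h :: "('n, 'k) mpoly \<Rightarrow> ('n, 'k) mpoly"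
    by (induction A rule: infinite_finite_induct) (auto simp: VV)
  have "\<forall>b\<in>B. \<exists>m. b - (\<Sum>e\<in>C. single 0 (m e) * e) \<in> W"
    using C BV unfolding quotient_basis_def by blast
  from bchoice[OF this] obtain M
    where M: "\<And>b. b \<in> B \<Longrightarrow> b - (\<Sum>e\<in>C. single 0 (M b e) * e) \<in> W"
    by blast
  obtain c where c: "\<exists>b\<in>B. c b \<noteq> 0" "\<forall>e\<in>C. (\<Sum>b\<in>B. c b * M b e) = 0"
    using nontrivial_dependency[OF fin(2,1) lt] by blast
  have sum_single: "(\<Sum>b\<in>B. single 0 (h b)) = single (0 :: 'n monom) (\<Sum>b\<in>B. h b)" for h :: "_ \<Rightarrow> 'k"
    by (rule poly_mapping_eqI) (simp add: lookup_sum lookup_single when_def)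
  have "(\<Sum>b\<in>B. single 0 (c b) * (\<Sum>e\<in>C. single 0 (M b e) * e))
      = (\<Sum>b\<in>B. \<Sum>e\<in>C. single 0 (c b * M b e) * e)"
    by (simp only: sum_distrib_left mult.assoc[symmetric] mult_single add_0_left)
  also have "\<dots> = (\<Sum>e\<in>C. single 0 (\<Sum>b\<in>B. c b * M b e) * e)"
    by (subst sum.swap) (simp only: sum_single[symmetric] sum_distrib_right)
  also have "\<dots> = 0"
    using c(2) by simp
  finally have zero: "(\<Sum>b\<in>B. single 0 (c b) * (\<Sum>e\<in>C. single 0 (M b e) * e)) = 0" .
  have "(\<Sum>b\<in>B. single 0 (c b) * (b - (\<Sum>e\<in>C. single 0 (M b e) * e))) \<in> W'"
    using M W by (intro ideal.subspace_sum ideal.subspace_scale) auto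
  then have "(\<Sum>b\<in>B. single 0 (c b) * b) \<in> W'"
    by (simp add: right_diff_distrib sum_subtractf zero)
  then have "- (\<Sum>b\<in>B. single 0 (c b) * b) \<in> W'"
    using ideal.subspace_neg[OF W(1)] by simp
  moreover have "- (\<Sum>b\<in>B. single 0 (c b) * b) = (\<Sum>b\<in>B. single 0 (- c b) * b)"
    by (simp add: sum_negf[symmetric] single_uminus)
  moreover have "(\<Sum>b\<in>B. single 0 (- c b) * b) \<in> V"
    using VV BV by (intro Vsum) auto
  ultimately have W0: "- (\<Sum>b\<in>B. single 0 (c b) * b) \<in> W"
    using W(2) by simp
  define c' where "c' b = (if b \<in> B then c b else 0)" for b
  have "(\<forall>b. b \<notin> B \<longrightarrow> c' b = 0) \<and> 0 - (\<Sum>b\<in>B. single 0 (c' b) * b) \<in> W"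
    using W0 by (simp add: c'_def)
  moreover have "(\<forall>b. b \<notin> B \<longrightarrow> (0::'k) = 0) \<and> 0 - (\<Sum>b\<in>B. single 0 0 * b) \<in> W"
    using W VV(3) by (simp add: ideal.subspace_0)
  moreover have "\<exists>!c :: ('n, 'k) mpoly \<Rightarrow> 'k. (\<forall>b. b \<notin> B \<longrightarrow> c b = 0) \<and>
        0 - (\<Sum>b\<in>B. single 0 (c b) * b) \<in> W"
    using B VV(3) unfolding quotient_basis_def by blast
  ultimately have "c' = (\<lambda>_. 0)"
    by (rule ex1_implies_eq)
  with c(1) show False
    by (metis c'_def)
qed

section \<open>Vanishing ideals and standard monomials\<close>

lemma proj_space_scale:
  assumes "p \<in> proj_space" "v \<in> p" "w \<in> p"
  obtains c where "w = c *s v"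
proof -
  obtain u where u: "p = proj_rel `` {u}"
    using assms(1) by (auto simp: proj_space_def quotient_def)
  obtain c c' where c: "c \<noteq> 0" "v = c *s u" "w = c' *s u"
    using assms(2,3) u by (auto simp: proj_rel_def)
  have "w = (c' / c) *s v"
    using c by (simp add: vec_eq_iff)
  then show ?thesis
    by (rule that)
qed

lemma proj_space_ex: "p \<in> proj_space \<Longrightarrow> \<exists>v. v \<in> p \<and> v \<noteq> 0"
  by (auto simp: proj_space_def quotient_def proj_rel_def) (metis one_neq_zero vector_smult_lid)

lemma mpoly_eval_proj:
  assumes "p \<in> proj_space" "v \<in> p" "w \<in> p" "homogeneous d f" "mpoly_eval f v = 0"
  shows "mpoly_eval f w = 0"
  using proj_space_scale[OF assms(1-3)] mpoly_eval_scale[OF assms(4)] assms(5)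
  by (metis mult_zero_right)

text \<open>The degree \<open>d\<close> piece of the vanishing ideal, described by vanishing alone;
  \<open>vanishing_ideal_homogeneous\<close> identifies the two.\<close>

definition vanishing_forms :: "('k::field ^ 'n::finite) set set \<Rightarrow> nat \<Rightarrow> ('n, 'k) mpoly set" where
  "vanishing_forms X d = {f. homogeneous d f \<and> (\<forall>p\<in>X. \<forall>v\<in>p. mpoly_eval f v = 0)}"

text \<open>Elements of the span need not be homogeneous, and their values at \<open>v\<close> alone
  do not control their components. The kernel of \<open>line.extend v\<close> is an ideal that
  contains the generators and does control them.\<close>

lemma line_vanishing_ideal:
  assumes "f \<in> vanishing_ideal X" "p \<in> X" "v \<in> p"
  shows "line.extend v f = 0"
proof -
  have "vanishing_ideal X \<subseteq> {f. line.extend v f = 0}"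
    unfolding vanishing_ideal_def
  proof (rule ideal.span_minimal)
    show "{f. (\<exists>d. homogeneous d f) \<and> (\<forall>p\<in>X. \<forall>v\<in>p. mpoly_eval f v = 0)} \<subseteq> {f. line.extend v f = 0}"
      using assms(2,3) by (auto simp: line_homogeneous)
    show "ideal.subspace {f. line.extend v f = 0}"
      by (rule ideal.subspaceI) (simp_all add: line.extend_zero line.extend_add line.extend_mult)
  qed
  then show ?thesis
    using assms(1) by auto
qed

lemma vanishing_forms_subset: "vanishing_forms X d \<subseteq> vanishing_ideal X"
  unfolding vanishing_ideal_def vanishing_forms_def by (auto intro!: ideal.span_base)

lemma vanishing_ideal_homogeneous: "{f \<in> vanishing_ideal X. homogeneous d f} = vanishing_forms X d"
  using vanishing_forms_subset[of X d] line_vanishing_ideal[of _ X]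
  by (fastforce simp: vanishing_forms_def line_homogeneous)

lemma vanishing_forms_zero: "0 \<in> vanishing_forms X d"
  by (simp add: vanishing_forms_def mpoly_eval_def)

lemma vanishing_forms_add:
  "f \<in> vanishing_forms X d \<Longrightarrow> g \<in> vanishing_forms X d \<Longrightarrow> f + g \<in> vanishing_forms X d"
  by (auto simp: vanishing_forms_def homogeneous_add mpoly_eval_eq eval.extend_add)

lemma vanishing_forms_diff:
  "f \<in> vanishing_forms X d \<Longrightarrow> g \<in> vanishing_forms X d \<Longrightarrow> f - g \<in> vanishing_forms X d"
  by (auto simp: vanishing_forms_def homogeneous_diff mpoly_eval_eq eval.extend_diff)

lemma vanishing_forms_scale:
  "f \<in> vanishing_forms X d \<Longrightarrow> single 0 c * f \<in> vanishing_forms X d"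
  by (auto simp: vanishing_forms_def homogeneous_scale mpoly_eval_eq eval.extend_mult)

text \<open>Relational counterpart of \<open>lead_monom\<close>: it fails for the zero polynomial,
  where the description operator would still denote some monomial.\<close>

definition is_lead :: "('n monom \<times> 'n monom) set \<Rightarrow> ('n::finite, 'k::field) mpoly \<Rightarrow> 'n monom \<Rightarrow> bool" where
  "is_lead r f a \<longleftrightarrow> a \<in> keys f \<and> (\<forall>b\<in>keys f. (b, a) \<in> r)"

definition monom_multiples :: "'n monom set \<Rightarrow> 'n monom set" where
  "monom_multiples M = {m + b | m b. m \<in> M}"

text \<open>The polynomials supported on a set of exponents closed under adding arbitrary exponents
  form an ideal.\<close>

lemma keys_span_single:
  fixes f :: "('n::finite, 'k::field) mpoly"
  assumes "f \<in> ideal.span ((\<lambda>m. single m 1) ` M)"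
  shows "keys f \<subseteq> monom_multiples M"
proof -
  have "ideal.span ((\<lambda>m. single m (1::'k)) ` M) \<subseteq> {f. keys f \<subseteq> monom_multiples M}"
  proof (rule ideal.span_minimal)
    show "(\<lambda>m. single m (1::'k)) ` M \<subseteq> {f. keys f \<subseteq> monom_multiples M}"
      by (fastforce simp: monom_multiples_def intro: exI[of _ 0])
    show "ideal.subspace {f :: ('n, 'k) mpoly. keys f \<subseteq> monom_multiples M}"
    proof (rule ideal.subspaceI; clarsimp)
      fix f g :: "('n, 'k) mpoly" and a
      assume "keys f \<subseteq> monom_multiples M" "keys g \<subseteq> monom_multiples M" "a \<in> keys (f + g)"
      then show "a \<in> monom_multiples M"
        using Poly_Mapping.keys_add[of f g] by auto
    next
      fix f g :: "('n, 'k) mpoly" and a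
      assume "keys f \<subseteq> monom_multiples M" "a \<in> keys (g * f)"
      then obtain b m e where "a = b + (m + e)" "m \<in> M"
        using keys_mult[of g f] by (fastforce simp: monom_multiples_def)
      then have "a = m + (b + e)" "m \<in> M"
        by (simp_all add: ac_simps)
      then show "a \<in> monom_multiples M"
        unfolding monom_multiples_def by blast
    qed
  qed
  then show ?thesis
    using assms by auto
qed

section \<open>Leading monomials and normal forms modulo the vanishing ideal\<close>

locale monomial_initial_ideal =
  fixes X :: "('k::field ^ 'n::finite) set set" and r :: "('n monom \<times> 'n monom) set"
    and M :: "'n monom set"
  assumes points: "X \<subseteq> proj_space" and finite_points: "finite X"
    and order: "monomial_order r"
    and initial: "initial_ideal r (vanishing_ideal X) = ideal.span ((\<lambda>m. single m (1::'k)) ` M)"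
begin

lemma r_refl: "(a, a) \<in> r"
  and r_trans: "(a, b) \<in> r \<Longrightarrow> (b, c) \<in> r \<Longrightarrow> (a, c) \<in> r"
  and r_antisym: "(a, b) \<in> r \<Longrightarrow> (b, a) \<in> r \<Longrightarrow> a = b"
  and r_total: "(a, b) \<in> r \<or> (b, a) \<in> r"
  and r_wf: "wf (r - Id)"
  and r_mono: "(a, b) \<in> r \<Longrightarrow> (a + c, b + c) \<in> r"
proof -
  have wo: "well_order_on UNIV r"
    using order by (simp add: monomial_order_def)
  then have lin: "linear_order_on UNIV r" and "wf (r - Id)"
    by (auto simp: well_order_on_def)
  then show "wf (r - Id)" by simp
  show refl: "(a, a) \<in> r" for a
    using lin by (auto simp: order_on_defs refl_on_def)
  show "(a, b) \<in> r \<Longrightarrow> (b, c) \<in> r \<Longrightarrow> (a, c) \<in> r"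
    using lin by (auto simp: order_on_defs dest: transD)
  show "(a, b) \<in> r \<Longrightarrow> (b, a) \<in> r \<Longrightarrow> a = b"
    using lin by (auto simp: order_on_defs dest: antisymD)
  show "(a, b) \<in> r \<or> (b, a) \<in> r"
    using lin refl by (cases "a = b") (auto simp: order_on_defs total_on_def)
  show "(a, b) \<in> r \<Longrightarrow> (a + c, b + c) \<in> r"
    using order by (auto simp: monomial_order_def)
qed

lemma finite_max: "finite A \<Longrightarrow> A \<noteq> {} \<Longrightarrow> \<exists>a\<in>A. \<forall>b\<in>A. (b, a) \<in> r"
proof (induction A rule: finite_ne_induct)
  case (singleton a)
  then show ?case by (simp add: r_refl)
next
  case (insert x A)
  then obtain a where a: "a \<in> A" "\<forall>b\<in>A. (b, a) \<in> r"
    by auto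
  show ?case
  proof (cases "(x, a) \<in> r")
    case True
    with a show ?thesis by auto
  next
    case False
    then have "(a, x) \<in> r"
      using r_total by blast
    then have "\<forall>b\<in>insert x A. (b, x) \<in> r"
      using a r_trans r_refl by blast
    then show ?thesis by blast
  qed
qed

lemma lead_ex: "f \<noteq> 0 \<Longrightarrow> \<exists>a. is_lead r (f :: ('n, 'k) mpoly) a"
  using finite_max[of "keys f"] by (auto simp: is_lead_def)

lemma lead_monom_eq: "is_lead r f a \<Longrightarrow> lead_monom r f = a"
  unfolding lead_monom_def is_lead_def by (rule the_equality) (auto intro: r_antisym)

text \<open>Nothing cancels at the top: \<open>(a, b)\<close> is the only pair of exponents with sum
  \<open>a + b\<close>, so its coefficient is a product of two nonzero field elements.\<close>

lemma lead_mult: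
  fixes f g :: "('n, 'k) mpoly"
  assumes "is_lead r f a" "is_lead r g b"
  shows "is_lead r (f * g) (a + b)"
proof -
  have le: "(x + y, a + b) \<in> r" and eq: "x + y = a + b \<Longrightarrow> x = a \<and> y = b"
    if "x \<in> keys f" "y \<in> keys g" for x y
  proof -
    have 1: "(x + y, a + y) \<in> r"
      using assms(1) that by (auto simp: is_lead_def intro: r_mono)
    have 2: "(a + y, a + b) \<in> r"
      using assms(2) that r_mono[of y b a] by (auto simp: is_lead_def add.commute)
    show "(x + y, a + b) \<in> r"
      using 1 2 by (rule r_trans)
    show "x = a \<and> y = b" if "x + y = a + b"
      using 1 2 that r_antisym[of "a + b" "a + y"] by auto
  qed
  have "f * g = (\<Sum>x\<in>keys f. single x (lookup f x)) * (\<Sum>y\<in>keys g. single y (lookup g y))"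
    by (rule arg_cong2[where f = "(*)", OF poly_mapping_sum_single poly_mapping_sum_single])
  also have "\<dots> = (\<Sum>x\<in>keys f. \<Sum>y\<in>keys g. single (x + y) (lookup f x * lookup g y))"
    by (simp only: sum_product mult_single)
  finally have *: "f * g = \<dots>" .
  have "lookup (f * g) (a + b) = (\<Sum>x\<in>keys f. \<Sum>y\<in>keys g.
      lookup (single (x + y) (lookup f x * lookup g y)) (a + b))"
    unfolding * by (simp only: lookup_sum)
  also have "\<dots> = (\<Sum>x\<in>keys f. \<Sum>y\<in>keys g. if y = b then (if x = a then lookup f a * lookup g b else 0) else 0)"
    using eq by (intro sum.cong refl) (auto simp: lookup_single when_def)
  also have "\<dots> = lookup f a * lookup g b"
    using assms by (simp add: is_lead_def)
  finally have "a + b \<in> keys (f * g)"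
    using assms by (simp add: is_lead_def in_keys_iff)
  then show ?thesis
    using le keys_mult[of f g] unfolding is_lead_def by blast
qed

text \<open>The leading monomial survives in the component of its own degree, so the leading
  monomials of the ideal are those of vanishing forms.\<close>

lemma vanishing_ideal_component:
  assumes "f \<in> vanishing_ideal X" "is_lead r f a"
  obtains g where "g \<in> vanishing_forms X (monom_deg a)" "is_lead r g a"
proof -
  obtain g where g: "homogeneous (monom_deg a) g"
    "\<And>v. mpoly_eval g v = coeff (line.extend v f) (monom_deg a)"
    "\<And>b. lookup g b = (if monom_deg b = monom_deg a then lookup f b else 0)"
    using homogeneous_component[where d = "monom_deg a" and f = f] by blast
  show ?thesis
  proof (rule that[of g])
    show "g \<in> vanishing_forms X (monom_deg a)"
      using g(1,2) line_vanishing_ideal[OF assms(1)] by (simp add: vanishing_forms_def)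
    show "is_lead r g a"
      using assms(2) g(3) by (auto simp: is_lead_def in_keys_iff split: if_splits)
  qed
qed

lemma lead_vanishing_form:
  assumes "f \<in> vanishing_forms X d" "is_lead r f a"
  shows "a \<in> monom_multiples M"
proof -
  have "f \<noteq> 0"
    using assms(2) by (auto simp: is_lead_def)
  then have "single (lead_monom r f) 1 \<in> initial_ideal r (vanishing_ideal X)"
    using assms(1) vanishing_forms_subset unfolding initial_ideal_def
    by (blast intro: ideal.span_base)
  then show ?thesis
    using keys_span_single[of "single a (1::'k)" M] lead_monom_eq[OF assms(2)] initial by simp
qed

text \<open>Membership of a generator in the initial ideal only says that it is a multiple of some
  leading monomial. Multiplying the corresponding polynomial by the missing monomial turns
  \<open>a\<close> itself into a leading monomial.\<close>

lemma multiple_is_lead: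
  assumes "a \<in> monom_multiples M"
  obtains g where "g \<in> vanishing_forms X (monom_deg a)" "is_lead r g a"
proof -
  obtain m b where mb: "m \<in> M" "a = m + b"
    using assms by (auto simp: monom_multiples_def)
  define L where "L = {lead_monom r f | f. f \<in> vanishing_ideal X \<and> f \<noteq> 0}"
  have "single m (1::'k) \<in> initial_ideal r (vanishing_ideal X)"
    unfolding initial using mb(1) by (auto intro: ideal.span_base)
  moreover have "{single (lead_monom r f) 1 | f. f \<in> vanishing_ideal X \<and> f \<noteq> 0}
      = (\<lambda>m. single m (1::'k)) ` L"
    by (auto simp: L_def)
  ultimately have "single m (1::'k) \<in> ideal.span ((\<lambda>m. single m (1::'k)) ` L)"
    by (simp add: initial_ideal_def)
  then have "m \<in> monom_multiples L"
    using keys_span_single by fastforce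
  then obtain f e where f: "f \<in> vanishing_ideal X" "f \<noteq> 0" "m = lead_monom r f + e"
    by (auto simp: monom_multiples_def L_def)
  obtain l where l: "is_lead r f l"
    using lead_ex f(2) by blast
  have a: "a = (e + b) + l"
    using mb f(3) lead_monom_eq[OF l] by (simp add: ac_simps)
  have "is_lead r (single (e + b) (1::'k)) (e + b)"
    by (simp add: is_lead_def r_refl)
  from lead_mult[OF this l] have "is_lead r (single (e + b) 1 * f) a"
    unfolding a .
  moreover have "single (e + b) 1 * f \<in> vanishing_ideal X"
    using f(1) unfolding vanishing_ideal_def by (rule ideal.span_scale)
  ultimately show ?thesis
    using vanishing_ideal_component that by blast
qed

lemma standard_form_zero:
  assumes "f \<in> vanishing_forms X d" "keys f \<inter> monom_multiples M = {}"
  shows "f = 0"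
  using assms lead_ex lead_vanishing_form by (fastforce simp: is_lead_def)

text \<open>Division with remainder. The induction runs over a bound \<open>a\<close> for the
  nonstandard monomials of \<open>f\<close>, because its leading monomial may be standard and then
  never decreases.\<close>

lemma normal_form_below:
  assumes "homogeneous d f" "\<forall>b\<in>keys f \<inter> monom_multiples M. (b, a) \<in> r"
  shows "\<exists>g\<in>vanishing_forms X d. keys (f - g) \<inter> monom_multiples M = {}"
  using r_wf assms
proof (induction a arbitrary: f rule: wf_induct_rule)
  case (less a)
  show ?case
  proof (cases "keys f \<inter> monom_multiples M = {}")
    case True
    then show ?thesis
      by (intro bexI[of _ 0]) (simp_all add: vanishing_forms_zero)
  next
    case False
    then obtain l where l: "l \<in> keys f" "l \<in> monom_multiples M"
      "\<forall>b\<in>keys f \<inter> monom_multiples M. (b, l) \<in> r"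
      using finite_max[of "keys f \<inter> monom_multiples M"] by auto
    have deg: "monom_deg l = d"
      using l(1) less.prems(1) by (auto simp: homogeneous_def)
    obtain g where g: "g \<in> vanishing_forms X d" "is_lead r g l"
      using multiple_is_lead[OF l(2)] deg by blast
    define h where "h = single 0 (lookup f l / lookup g l) * g"
    have gl: "lookup g l \<noteq> 0"
      using g(2) by (auto simp: is_lead_def in_keys_iff)
    have h: "h \<in> vanishing_forms X d"
      unfolding h_def using g(1) by (rule vanishing_forms_scale)
    have lh: "lookup h b = lookup f l / lookup g l * lookup g b" for b
      unfolding h_def by (rule lookup_scalar_mult)
    have "l \<notin> keys (f - h)"
      using gl by (simp add: in_keys_iff lookup_minus lh)
    moreover have "(b, l) \<in> r" if "b \<in> keys (f - h) \<inter> monom_multiples M" for b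
    proof -
      have "b \<in> keys f \<or> b \<in> keys g"
        using that keys_diff_subset[of f h] by (auto simp: in_keys_iff lh)
      then show ?thesis
        using that l(3) g(2) by (auto simp: is_lead_def)
    qed
    ultimately have below: "\<forall>b\<in>keys (f - h) \<inter> monom_multiples M. (b, l) \<in> r \<and> b \<noteq> l"
      by auto
    have hom: "homogeneous d (f - h)"
      using less.prems(1) h by (auto simp: vanishing_forms_def intro: homogeneous_diff)
    have "\<exists>g\<in>vanishing_forms X d. keys (f - h - g) \<inter> monom_multiples M = {}"
    proof (cases "keys (f - h) \<inter> monom_multiples M = {}")
      case True
      then show ?thesis
        by (intro bexI[of _ 0]) (simp_all add: vanishing_forms_zero)
    next
      case False
      then obtain m where m: "m \<in> keys (f - h) \<inter> monom_multiples M"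
        "\<forall>b\<in>keys (f - h) \<inter> monom_multiples M. (b, m) \<in> r"
        using finite_max[of "keys (f - h) \<inter> monom_multiples M"] by auto
      have "(m, l) \<in> r" "m \<noteq> l" "(l, a) \<in> r"
        using below m(1) l(1,2) less.prems(2) by auto
      then have "(m, a) \<in> r - Id"
        using r_trans r_antisym by blast
      then show ?thesis
        using less.IH hom m(2) by blast
    qed
    then obtain g' where g': "g' \<in> vanishing_forms X d" "keys (f - h - g') \<inter> monom_multiples M = {}"
      by blast
    have "keys (f - (h + g')) \<inter> monom_multiples M = {}"
      using g'(2) by (simp only: diff_diff_eq)
    then show ?thesis
      using vanishing_forms_add[OF h g'(1)] by blast
  qed
qed

lemma normal_form:
  assumes "homogeneous d f"
  obtains g where "g \<in> vanishing_forms X d" "keys (f - g) \<inter> monom_multiples M = {}"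
proof (cases "keys f = {}")
  case True
  then show ?thesis
    using that[of 0] by (simp add: vanishing_forms_zero)
next
  case False
  then show ?thesis
    using normal_form_below[OF assms] finite_max[of "keys f"] that by (metis IntE finite_keys)
qed

section \<open>Standard monomials and the Hilbert function\<close>

definition standard :: "nat \<Rightarrow> 'n monom set" where
  "standard d = {a. monom_deg a = d \<and> a \<notin> monom_multiples M}"

lemma finite_standard: "finite (standard d)"
  unfolding standard_def by (rule finite_subset[OF _ finite_monom_deg[of d]]) auto

lemma standard_span:
  assumes "homogeneous d f" "keys f \<inter> monom_multiples M = {}"
  shows "f = (\<Sum>a\<in>standard d. single a (lookup f a))"
proof -
  have "keys f \<subseteq> standard d"
    using assms by (auto simp: homogeneous_def standard_def)
  then have "(\<Sum>a\<in>keys f. single a (lookup f a)) = (\<Sum>a\<in>standard d. single a (lookup f a))"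
    by (intro sum.mono_neutral_left finite_standard) (auto simp: in_keys_iff)
  then show ?thesis
    using poly_mapping_sum_single[of f] by simp
qed

lemma standard_sum:
  fixes d :: nat and c :: "'n monom \<Rightarrow> 'k"
  defines "f \<equiv> (\<Sum>a\<in>standard d. single a (c a))"
  shows "homogeneous d f" "keys f \<inter> monom_multiples M = {}"
    "lookup f a = (if a \<in> standard d then c a else 0)"
proof -
  show l: "lookup f a = (if a \<in> standard d then c a else 0)" for a
    unfolding f_def using finite_standard by (simp add: lookup_sum lookup_single when_def)
  show "homogeneous d f"
    unfolding f_def by (intro homogeneous_sum homogeneous_single) (simp add: standard_def)
  show "keys f \<inter> monom_multiples M = {}"
    by (auto simp: in_keys_iff l standard_def split: if_splits)
qed

text \<open>Coordinates exist by the normal form. They are unique because two normal forms differ by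
  a vanishing form without nonstandard monomials, which is 0.\<close>

lemma standard_quotient_basis:
  "quotient_basis {f. homogeneous d f} (vanishing_forms X d) ((\<lambda>a. single a (1::'k)) ` standard d)"
  unfolding quotient_basis_def
proof (intro conjI ballI)
  let ?B = "(\<lambda>a. single a (1::'k)) ` standard d"
  have inj: "inj_on (\<lambda>a. single a (1::'k)) (standard d)"
    by (rule inj_onI) (metis keys_single one_neq_zero singleton_inject)
  show "finite ?B"
    using finite_standard by simp
  show "?B \<subseteq> {f. homogeneous d f}"
    by (auto simp: standard_def intro: homogeneous_single)
  have sumB: "(\<Sum>b\<in>?B. single 0 (c b) * b) = (\<Sum>a\<in>standard d. single a (c (single a 1)))"
    for c :: "('n, 'k) mpoly \<Rightarrow> 'k"
    by (subst sum.reindex[OF inj]) (simp add: mult_single)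
  fix f :: "('n, 'k) mpoly"
  assume "f \<in> {f. homogeneous d f}"
  then have hom: "homogeneous d f" by simp
  obtain g where g: "g \<in> vanishing_forms X d" "keys (f - g) \<inter> monom_multiples M = {}"
    using normal_form[OF hom] by blast
  have homg: "homogeneous d (f - g)"
    using hom g(1) by (auto simp: vanishing_forms_def intro: homogeneous_diff)
  show "\<exists>!c. (\<forall>b. b \<notin> ?B \<longrightarrow> c b = (0::'k)) \<and>
      f - (\<Sum>b\<in>?B. single 0 (c b) * b) \<in> vanishing_forms X d"
  proof (rule ex1I)
    \<comment> \<open>\<open>the_elem (keys b)\<close> recovers the exponent of the monomial
      \<open>b\<close>; the value 0 off the basis is demanded by
      \<open>quotient_basis\<close>.\<close>
    let ?c = "\<lambda>b. if b \<in> ?B then lookup (f - g) (the_elem (keys b)) else 0"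
    have "(\<Sum>b\<in>?B. single 0 (?c b) * b) = (\<Sum>a\<in>standard d. single a (lookup (f - g) a))"
      unfolding sumB by (intro sum.cong) auto
    also have "\<dots> = f - g"
      using standard_span[OF homg g(2)] by simp
    finally show "(\<forall>b. b \<notin> ?B \<longrightarrow> ?c b = 0) \<and>
        f - (\<Sum>b\<in>?B. single 0 (?c b) * b) \<in> vanishing_forms X d"
      using g(1) by simp
  next
    fix c :: "('n, 'k) mpoly \<Rightarrow> 'k"
    assume c: "(\<forall>b. b \<notin> ?B \<longrightarrow> c b = 0) \<and> f - (\<Sum>b\<in>?B. single 0 (c b) * b) \<in> vanishing_forms X d"
    define h where "h = (\<Sum>a\<in>standard d. single a (c (single a 1)))"
    have "f - h \<in> vanishing_forms X d"
      using c unfolding h_def sumB by simp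
    then have "(f - h) - g \<in> vanishing_forms X d"
      using g(1) by (rule vanishing_forms_diff)
    moreover have "(f - h) - g = (f - g) - h"
      by simp
    moreover have "keys ((f - g) - h) \<inter> monom_multiples M = {}"
      using keys_diff_subset[of "f - g" h] g(2) standard_sum(2)[where d = d and c = "\<lambda>a. c (single a 1)"]
      unfolding h_def by blast
    ultimately have "f - g - h = 0"
      using standard_form_zero by metis
    then have "f - g = h"
      by simp
    then have "c (single a 1) = lookup (f - g) a" if "a \<in> standard d" for a
      using standard_sum(3)[where d = d and c = "\<lambda>a. c (single a 1)" and a = a] that by (simp add: h_def)
    then show "c = (\<lambda>b. if b \<in> ?B then lookup (f - g) (the_elem (keys b)) else 0)"
      using c by (intro ext) auto
  qed
qed

lemma hilbert_fun_standard: "hilbert_fun (vanishing_ideal X) d = card (standard d)"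
proof -
  let ?V = "{f :: ('n, 'k) mpoly. homogeneous d f}" and ?B = "(\<lambda>a. single a (1::'k)) ` standard d"
  let ?C = "SOME B. quotient_basis ?V (vanishing_forms X d) B"
  have C: "quotient_basis ?V (vanishing_forms X d) ?C"
    by (rule someI) (rule standard_quotient_basis)
  have I: "ideal.subspace (vanishing_ideal X)"
    unfolding vanishing_ideal_def by simp
  have W: "vanishing_forms X d = vanishing_ideal X \<inter> ?V"
    using vanishing_ideal_homogeneous[of X d] by auto
  note le = quotient_basis_card_le[OF I W]
  have "card ?C = card ?B"
    by (intro antisym le C standard_quotient_basis) (auto intro: homogeneous_add homogeneous_scale)
  moreover have "card ?B = card (standard d)"
    by (intro card_image inj_onI) (metis keys_single one_neq_zero singleton_inject)
  ultimately show ?thesis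
    unfolding hilbert_fun_def quotient_dim_def vanishing_ideal_homogeneous by simp
qed

lemma card_standard_le: "card (standard d) \<le> card X"
proof (rule ccontr)
  assume "\<not> ?thesis"
  then have lt: "card X < card (standard d)"
    by simp
  define rep where "rep p = (SOME v. v \<in> p)" for p :: "('k ^ 'n) set"
  have rep: "rep p \<in> p" if "p \<in> X" for p
  proof -
    have "p \<in> proj_space"
      using that points by blast
    then obtain v where "v \<in> p"
      using proj_space_ex by blast
    then show ?thesis
      unfolding rep_def by (rule someI)
  qed
  obtain c where c: "\<exists>a\<in>standard d. c a \<noteq> 0"
    "\<forall>p\<in>X. (\<Sum>a\<in>standard d. c a * monom_eval (rep p) a) = 0"
    using nontrivial_dependency[OF finite_points finite_standard lt, of "\<lambda>a p. monom_eval (rep p) a"]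
    by blast
  define f where "f = (\<Sum>a\<in>standard d. single a (c a))"
  note f = standard_sum[where d = d and c = c, folded f_def]
  have "mpoly_eval f (rep p) = 0" if "p \<in> X" for p
    using c(2) that by (simp add: f_def mpoly_eval_eq eval.extend_sum eval.extend_single)
  \<comment> \<open>The dependency only sees one representative per point; homogeneity extends the
    vanishing to all of them.\<close>
  then have "mpoly_eval f v = 0" if "p \<in> X" "v \<in> p" for p v
    using mpoly_eval_proj[OF _ rep[OF that(1)] that(2) f(1)] points that(1) by blast
  then have "f \<in> vanishing_forms X d"
    using f(1) by (simp add: vanishing_forms_def)
  then have "f = 0"
    using f(2) by (rule standard_form_zero)
  then have "c a = 0" if "a \<in> standard d" for a
    using f(3)[of a] that by simp
  then show False
    using c(1) by blast
qed

end

section \<open>Monomials with disjoint supports\<close>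

lemma monom_multiples_iff:
  "a \<in> monom_multiples (\<alpha> ` I) \<longleftrightarrow> (\<exists>i\<in>I. \<forall>x. lookup (\<alpha> i) x \<le> lookup a x)"
proof
  show "\<exists>i\<in>I. \<forall>x. lookup (\<alpha> i) x \<le> lookup a x" if "a \<in> monom_multiples (\<alpha> ` I)"
  proof -
    from that obtain i b where "i \<in> I" "a = \<alpha> i + b"
      unfolding monom_multiples_def by blast
    then show ?thesis
      by (intro bexI[of _ i]) (simp_all add: lookup_add)
  qed
  show "a \<in> monom_multiples (\<alpha> ` I)" if "\<exists>i\<in>I. \<forall>x. lookup (\<alpha> i) x \<le> lookup a x"
  proof -
    from that obtain i where i: "i \<in> I" "\<And>x. lookup (\<alpha> i) x \<le> lookup a x"
      by blast
    have "a = \<alpha> i + (a - \<alpha> i)"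
      by (rule poly_mapping_eqI) (simp add: lookup_add lookup_minus i(2))
    with i(1) show ?thesis
      unfolding monom_multiples_def by blast
  qed
qed

lemma monom_deg_keys: "monom_deg a = (\<Sum>x\<in>keys a. lookup a x)"
  unfolding monom_deg_def by (rule sum.mono_neutral_right) (auto simp: in_keys_iff)

lemma card_compl: "card (- A) = CARD('n) - card A" for A :: "'n::finite set"
  by (simp add: Compl_eq_Diff_UNIV card_Diff_subset)

text \<open>
  Bounded Hilbert function forces a generator supported on each pair of variables, so every set of
  variables meeting all supports misses at most one variable.  Two generators sharing a variable
  would give such a set that is too small.
\<close>

lemma disjoint_keys_if_bounded:
  fixes \<alpha> :: "'i \<Rightarrow> ('n::finite) monom"
  assumes I: "finite I" "Suc (card I) = CARD('n)" and ne: "\<And>i. i \<in> I \<Longrightarrow> keys (\<alpha> i) \<noteq> {}"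
    and bound: "\<And>d. card {a. monom_deg a = d \<and> a \<notin> monom_multiples (\<alpha> ` I)} \<le> N"
    and kl: "k \<in> I" "l \<in> I" "k \<noteq> l"
  shows "keys (\<alpha> k) \<inter> keys (\<alpha> l) = {}"
proof (rule ccontr)
  assume "keys (\<alpha> k) \<inter> keys (\<alpha> l) \<noteq> {}"
  then obtain t where t: "t \<in> keys (\<alpha> k)" "t \<in> keys (\<alpha> l)"
    by blast
  have pair: "\<exists>i\<in>I. keys (\<alpha> i) \<subseteq> {x, y}" if "x \<noteq> y" for x y
  proof -
    \<comment> \<open>The \<open>N + 1\<close> monomials of degree \<open>N\<close> in the two
      variables: one too many for all of them to be standard.\<close>
    let ?m = "\<lambda>e. single x e + single y (N - e)"
    let ?S = "{a. monom_deg a = N \<and> a \<notin> monom_multiples (\<alpha> ` I)}"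
    have "inj_on ?m {..N}"
    proof (rule inj_onI)
      fix e e' assume "?m e = ?m e'"
      then have "lookup (?m e) x = lookup (?m e') x"
        by simp
      then show "e = e'"
        using that by (simp add: lookup_add lookup_single)
    qed
    then have "card (?m ` {..N}) = Suc N"
      by (simp add: card_image)
    moreover have "finite ?S"
      by (rule finite_subset[OF _ finite_monom_deg[of N]]) auto
    ultimately have "\<not> ?m ` {..N} \<subseteq> ?S"
      using bound[of N] card_mono[of ?S "?m ` {..N}"] by linarith
    then obtain e where "e \<le> N" "?m e \<in> monom_multiples (\<alpha> ` I)"
      by auto
    then obtain i where i: "i \<in> I" "\<And>z. lookup (\<alpha> i) z \<le> lookup (?m e) z"
      by (auto simp: monom_multiples_iff)
    have "z \<in> {x, y}" if "z \<in> keys (\<alpha> i)" for z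
      using i(2)[of z] that by (auto simp: in_keys_iff lookup_add lookup_single when_def split: if_splits)
    with i(1) show ?thesis
      by blast
  qed
  \<comment> \<open>A choice of one variable from each support that takes \<open>t\<close> for both
    \<open>k\<close> and \<open>l\<close>. It uses at most \<open>card I - 1\<close> variables and
    so misses at least two, and a generator in these two alone contradicts the choice.\<close>
  define h where "h i = (if i = k \<or> i = l then t else SOME x. x \<in> keys (\<alpha> i))" for i
  have h: "h i \<in> keys (\<alpha> i)" if "i \<in> I" for i
    using ne[OF that] t by (auto simp: h_def some_in_eq)
  have "h ` I = h ` (I - {l})"
    using kl by (auto simp: h_def)
  then have "card (h ` I) \<le> card (I - {l})"
    using I(1) by (simp add: card_image_le)
  then have "card (h ` I) < card I"
    using card_Diff1_less[OF I(1) kl(2)] by linarith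
  then have "\<not> card (- h ` I) \<le> Suc 0"
    using I(2) by (simp add: card_compl)
  then obtain x y where xy: "x \<notin> h ` I" "y \<notin> h ` I" "x \<noteq> y"
    by (auto simp: card_le_Suc0_iff_eq)
  obtain i where "i \<in> I" "keys (\<alpha> i) \<subseteq> {x, y}"
    using pair[OF xy(3)] by blast
  then show False
    using h xy(1,2) by blast
qed

lemma two_standard_successors:
  fixes \<alpha> :: "'i \<Rightarrow> ('n::finite) monom"
  assumes I: "finite I" "Suc (card I) = CARD('n)"
    and disj: "\<And>k l. k \<in> I \<Longrightarrow> l \<in> I \<Longrightarrow> k \<noteq> l \<Longrightarrow> keys (\<alpha> k) \<inter> keys (\<alpha> l) = {}"
    and a: "a \<notin> monom_multiples (\<alpha> ` I)" "monom_deg a < (\<Sum>i\<in>I. monom_deg (\<alpha> i) - 1)"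
  obtains x y where "x \<noteq> y" "a + single x 1 \<notin> monom_multiples (\<alpha> ` I)"
    "a + single y 1 \<notin> monom_multiples (\<alpha> ` I)"
proof -
  define Bad where "Bad = {x. a + single x 1 \<in> monom_multiples (\<alpha> ` I)}"
  have "\<forall>x\<in>Bad. \<exists>i. i \<in> I \<and> (\<forall>z. lookup (\<alpha> i) z \<le> lookup (a + single x 1) z)"
    unfolding Bad_def monom_multiples_iff by blast
  from bchoice[OF this] obtain h
    where h: "\<And>x. x \<in> Bad \<Longrightarrow> h x \<in> I"
      and le: "\<And>x z. x \<in> Bad \<Longrightarrow> lookup (\<alpha> (h x)) z \<le> lookup (a + single x 1) z"
    by blast
  have le': "lookup (\<alpha> (h x)) z \<le> lookup a z" if "x \<in> Bad" "z \<noteq> x" for x z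
    using le[OF that(1), of z] that(2) by (simp add: lookup_add lookup_single)
  \<comment> \<open>Since \<open>a\<close> itself is standard, the only exponent at which
    \<open>\<alpha> (h x)\<close> can exceed \<open>a\<close> is that of the added variable, and it
    does so by one.\<close>
  have at: "lookup (\<alpha> (h x)) x = Suc (lookup a x)" if x: "x \<in> Bad" for x
  proof -
    obtain z where "\<not> lookup (\<alpha> (h x)) z \<le> lookup a z"
      using a(1) h[OF x] by (auto simp: monom_multiples_iff)
    then show ?thesis
      using le[OF x, of z] le'[OF x, of z] by (cases "z = x") (auto simp: lookup_add lookup_single)
  qed
  have inj: "inj_on h Bad"
  proof (rule inj_onI, rule ccontr)
    fix x y assume "x \<in> Bad" "y \<in> Bad" "h x = h y" "x \<noteq> y"
    then show False
      using at[of x] le'[of y x] by simp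
  qed
  have "card Bad < card I"
  proof (rule ccontr)
    assume "\<not> ?thesis"
    then have "card I \<le> card (h ` Bad)"
      using inj by (simp add: card_image)
    then have "h ` Bad = I"
      using I(1) h by (intro card_seteq) auto
    \<comment> \<open>Within its support, the generator loses to \<open>a\<close> at every variable
      except its bad one, where it is ahead by one.\<close>
    have deg: "monom_deg (\<alpha> i) - 1 \<le> (\<Sum>z\<in>keys (\<alpha> i). lookup a z)" if i: "i \<in> I" for i
    proof -
      obtain x where x: "x \<in> Bad" "i = h x"
        using \<open>h ` Bad = I\<close> i by blast
      have xk: "x \<in> keys (\<alpha> i)"
        using at[OF x(1)] x(2) by (simp add: in_keys_iff)
      have "monom_deg (\<alpha> i) = lookup (\<alpha> i) x + (\<Sum>z\<in>keys (\<alpha> i) - {x}. lookup (\<alpha> i) z)"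
        unfolding monom_deg_keys using xk by (simp add: sum.remove)
      also have "\<dots> \<le> Suc (lookup a x) + (\<Sum>z\<in>keys (\<alpha> i) - {x}. lookup a z)"
        using at[OF x(1)] le'[OF x(1)] x(2) by (intro add_mono sum_mono) auto
      also have "\<dots> = Suc (\<Sum>z\<in>keys (\<alpha> i). lookup a z)"
        using xk by (simp add: sum.remove)
      finally show ?thesis
        by simp
    qed
    have "(\<Sum>i\<in>I. monom_deg (\<alpha> i) - 1) \<le> (\<Sum>i\<in>I. \<Sum>z\<in>keys (\<alpha> i). lookup a z)"
      using deg by (rule sum_mono)
    also have "\<dots> = (\<Sum>z\<in>(\<Union>i\<in>I. keys (\<alpha> i)). lookup a z)"
      using I(1) disj by (subst sum.UNION_disjoint) auto
    also have "\<dots> \<le> monom_deg a"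
      unfolding monom_deg_def by (rule sum_mono2) auto
    finally show False
      using a(2) by simp
  qed
  \<comment> \<open>At most \<open>card I - 1 = CARD('n) - 2\<close> variables are bad, which leaves
    two.\<close>
  then have "\<not> card (- Bad) \<le> Suc 0"
    using I(2) by (simp add: card_compl)
  then obtain x y where "x \<notin> Bad" "y \<notin> Bad" "x \<noteq> y"
    by (auto simp: card_le_Suc0_iff_eq)
  then show ?thesis
    using that by (simp add: Bad_def)
qed

text \<open>One variable chosen from each of the disjoint supports leaves exactly one variable
  \<open>q\<close>. Besides its own chosen variable a support can only contain \<open>q\<close>, and
  by disjointness at most one support does.\<close>

lemma disjoint_keys_structure:
  fixes \<alpha> :: "'i \<Rightarrow> ('n::finite) monom"
  assumes I: "finite I" "I \<noteq> {}" "Suc (card I) = CARD('n)"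
    and ne: "\<And>i. i \<in> I \<Longrightarrow> keys (\<alpha> i) \<noteq> {}"
    and disj: "\<And>k l. k \<in> I \<Longrightarrow> l \<in> I \<Longrightarrow> k \<noteq> l \<Longrightarrow> keys (\<alpha> k) \<inter> keys (\<alpha> l) = {}"
  obtains j q k where "inj_on j I" "j ` I = - {q}" "k \<in> I" "\<And>i. i \<in> I \<Longrightarrow> j i \<in> keys (\<alpha> i)"
    "\<And>i. i \<in> I \<Longrightarrow> i \<noteq> k \<Longrightarrow> keys (\<alpha> i) = {j i}" "keys (\<alpha> k) \<subseteq> {j k, q}"
proof -
  obtain j where j: "\<And>i. i \<in> I \<Longrightarrow> j i \<in> keys (\<alpha> i)"
    using bchoice[of I "\<lambda>i x. x \<in> keys (\<alpha> i)"] ne by blast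
  have inj: "inj_on j I"
    using j disj by (intro inj_onI) (metis IntI empty_iff)
  have "card (- j ` I) = 1"
    using I(3) inj by (simp add: card_compl card_image)
  then obtain q where "- j ` I = {q}"
    by (rule card_1_singletonE)
  then have q: "j ` I = - {q}"
    by blast
  have sub: "keys (\<alpha> i) \<subseteq> {j i, q}" if "i \<in> I" for i
  proof
    fix x assume x: "x \<in> keys (\<alpha> i)"
    show "x \<in> {j i, q}"
    proof (cases "x = q")
      case False
      then obtain i' where "i' \<in> I" "x = j i'"
        using q by blast
      then show ?thesis
        using j disj[of i i'] that x by auto
    qed simp
  qed
  obtain k where k: "k \<in> I" "\<And>i. i \<in> I \<Longrightarrow> i \<noteq> k \<Longrightarrow> q \<notin> keys (\<alpha> i)"
  proof (cases "\<exists>k\<in>I. q \<in> keys (\<alpha> k)")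
    case True
    then obtain k where "k \<in> I" "q \<in> keys (\<alpha> k)"
      by blast
    then show ?thesis
      using that[of k] disj[of k] by blast
  next
    \<comment> \<open>If \<open>q\<close> occurs in no generator, any index can play the role of
      \<open>k\<close>.\<close>
    case False
    then show ?thesis
      using that I(2) by blast
  qed
  show ?thesis
  proof (rule that[OF inj q k(1) j _ sub[OF k(1)]])
    show "keys (\<alpha> i) = {j i}" if "i \<in> I" "i \<noteq> k" for i
      using sub j k(2) that by blast
  qed
qed

text \<open>
  With \<open>p\<close>, \<open>q\<close>, \<open>u\<close>, \<open>v\<close> as in the proof, the \<open>k\<close>-th generator is \<open>x_p ^ u * x_q ^ v\<close> (where
  possibly \<open>v = 0\<close>) and the others are powers of the remaining variables.  The map \<open>\<sigma>\<close> multiplies a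
  standard monomial by whichever of \<open>x_p\<close>, \<open>x_q\<close> keeps it standard; it is injective, and the
  largest degree of a standard monomial outside its image is \<open>\<rho>\<close>.
\<close>

lemma standard_count:
  fixes \<alpha> :: "'i \<Rightarrow> ('n::finite) monom"
  assumes I: "finite I" "I \<noteq> {}" "Suc (card I) = CARD('n)"
    and ne: "\<And>i. i \<in> I \<Longrightarrow> keys (\<alpha> i) \<noteq> {}"
    and disj: "\<And>k l. k \<in> I \<Longrightarrow> l \<in> I \<Longrightarrow> k \<noteq> l \<Longrightarrow> keys (\<alpha> k) \<inter> keys (\<alpha> l) = {}"
  defines "S \<equiv> \<lambda>d. {a. monom_deg a = d \<and> a \<notin> monom_multiples (\<alpha> ` I)}"
    and "\<rho> \<equiv> \<Sum>i\<in>I. monom_deg (\<alpha> i) - 1"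
  shows "d \<ge> \<rho> \<Longrightarrow> card (S (Suc d)) = card (S d)"
    and "\<rho> = Suc d \<Longrightarrow> card (S d) < card (S (Suc d))"
proof -
  obtain j q k where jqk: "inj_on j I" "j ` I = - {q}" "k \<in> I"
    "\<And>i. i \<in> I \<Longrightarrow> j i \<in> keys (\<alpha> i)"
    "\<And>i. i \<in> I \<Longrightarrow> i \<noteq> k \<Longrightarrow> keys (\<alpha> i) = {j i}" "keys (\<alpha> k) \<subseteq> {j k, q}"
    using disjoint_keys_structure[of I \<alpha>] I ne disj by metis
  define p where "p = j k"
  define u where "u = lookup (\<alpha> k) p"
  define v where "v = lookup (\<alpha> k) q"
  define J where "J = I - {k}"
  define D where "D i = monom_deg (\<alpha> i)" for i
  have fin: "finite J" "k \<notin> J" "I = insert k J"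
    using I(1) jqk(3) by (auto simp: J_def)
  have pq: "p \<noteq> q" "u > 0"
    using jqk(2,3) jqk(4)[of k] by (auto simp: p_def u_def in_keys_iff)
  have jJ: "j i \<noteq> q" "j i \<noteq> p" if "i \<in> J" for i
    using that jqk(1-3) by (auto simp: J_def p_def inj_on_def)
  have Dpos: "D i > 0" and look: "lookup (\<alpha> i) x = (if x = j i then D i else 0)" if "i \<in> J" for i x
  proof -
    have k: "keys (\<alpha> i) = {j i}"
      using that jqk(5) by (simp add: J_def)
    then have "D i = lookup (\<alpha> i) (j i)"
      by (simp add: D_def monom_deg_keys)
    moreover from k have "lookup (\<alpha> i) (j i) \<noteq> 0"
      by (metis in_keys_iff singletonI)
    moreover have "lookup (\<alpha> i) x = 0" if "x \<noteq> j i"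
      using k that by (metis in_keys_iff singletonD)
    ultimately show "D i > 0" "lookup (\<alpha> i) x = (if x = j i then D i else 0)"
      by simp_all
  qed
  have UNIV: "UNIV = insert q (insert p (j ` J))"
    using jqk(2) fin(3) by (auto simp: p_def)
  have deg: "monom_deg a = lookup a q + lookup a p + (\<Sum>i\<in>J. lookup a (j i))" for a
  proof -
    have "inj_on j J"
      using jqk(1) by (rule inj_on_subset) (auto simp: J_def)
    then show ?thesis
      unfolding monom_deg_def UNIV using fin(1) pq(1) jJ
      by (subst sum.insert, simp, force, subst sum.insert, simp, force) (simp add: sum.reindex)
  qed
  have Dk: "D k = u + v"
  proof -
    have "lookup (\<alpha> k) (j i) = 0" if "i \<in> J" for i
      using jqk(6) jJ[OF that] by (auto simp: p_def in_keys_iff)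
    then show ?thesis
      by (simp add: D_def deg u_def v_def)
  qed
  have rho: "\<rho> = (\<Sum>i\<in>J. D i - 1) + (u + v - 1)"
    using fin Dk by (simp add: \<rho>_def D_def)
  \<comment> \<open>Standard exponents form a box in the coordinates \<open>j i\<close> times the
    L-shaped complement of the quadrant with corner \<open>(u, v)\<close> in the coordinates
    \<open>p\<close>, \<open>q\<close>.\<close>
  have std: "a \<notin> monom_multiples (\<alpha> ` I) \<longleftrightarrow>
      (\<forall>i\<in>J. lookup a (j i) < D i) \<and> (lookup a p < u \<or> lookup a q < v)" for a
  proof -
    have "(\<forall>x. lookup (\<alpha> k) x \<le> lookup a x) \<longleftrightarrow> u \<le> lookup a p \<and> v \<le> lookup a q"
    proof
      assume *: "u \<le> lookup a p \<and> v \<le> lookup a q"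
      show "\<forall>x. lookup (\<alpha> k) x \<le> lookup a x"
      proof
        fix x show "lookup (\<alpha> k) x \<le> lookup a x"
        proof (cases "x \<in> keys (\<alpha> k)")
          case True
          then have "x = p \<or> x = q"
            using jqk(6) by (auto simp: p_def)
          then show ?thesis
            using * by (auto simp: u_def v_def)
        next
          case False
          then show ?thesis
            by (simp add: in_keys_iff)
        qed
      qed
    qed (auto simp: u_def v_def)
    moreover have "(\<forall>x. lookup (\<alpha> i) x \<le> lookup a x) \<longleftrightarrow> D i \<le> lookup a (j i)" if "i \<in> J" for i
      using look[OF that] by auto
    ultimately show ?thesis
      unfolding monom_multiples_iff fin(3) by (auto simp: not_le)
  qed
  have finS: "finite (S d)" for d
    unfolding S_def by (rule finite_subset[OF _ finite_monom_deg[of d]]) auto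
  define \<sigma> where "\<sigma> a = a + single (if lookup a p < u then q else p) 1" for a
  have \<sigma>p: "lookup (\<sigma> a) p = (if lookup a p < u then lookup a p else Suc (lookup a p))"
    and \<sigma>q: "lookup (\<sigma> a) q = (if lookup a p < u then Suc (lookup a q) else lookup a q)"
    and \<sigma>j: "i \<in> J \<Longrightarrow> lookup (\<sigma> a) (j i) = lookup a (j i)" for a i
    using pq(1) jJ[of i] by (auto simp: \<sigma>_def lookup_add lookup_single when_def)
  have \<sigma>S: "\<sigma> ` S d \<subseteq> S (Suc d)" for d
  proof (rule image_subsetI)
    fix a assume "a \<in> S d"
    then show "\<sigma> a \<in> S (Suc d)"
      by (auto simp: S_def std \<sigma>j \<sigma>p \<sigma>q) (simp_all add: \<sigma>_def)
  qed
  have inj: "inj_on \<sigma> (S d)" for d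
  proof (rule inj_onI)
    fix a b assume eq: "\<sigma> a = \<sigma> b"
    \<comment> \<open>\<open>\<sigma>\<close> preserves the side of \<open>u\<close> on which the
      exponent of x_p lies, so the added factor can be read off from the image.\<close>
    then have "lookup a p < u \<longleftrightarrow> lookup b p < u"
      using \<sigma>p[of a] \<sigma>p[of b] by (auto split: if_splits)
    then show "a = b"
      using eq by (simp add: \<sigma>_def)
  qed
  have small: "(\<Sum>i\<in>J. lookup a (j i)) \<le> (\<Sum>i\<in>J. D i - 1)" if "a \<in> S d" for a d
    using that by (intro sum_mono) (fastforce simp: S_def std)
  show "card (S (Suc d)) = card (S d)" if d: "d \<ge> \<rho>"
  proof -
    have "S (Suc d) \<subseteq> \<sigma> ` S d"
    proof
      fix b assume b: "b \<in> S (Suc d)"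
      then have db: "monom_deg b = Suc d" and sb: "\<forall>i\<in>J. lookup b (j i) < D i"
          "lookup b p < u \<or> lookup b q < v"
        by (auto simp: S_def std)
      define y where "y = (if lookup b p < u then q else p)"
      define a where "a = b - single y 1"
      \<comment> \<open>If this failed, either x_q would be absent with the exponent of x_p below
        \<open>u\<close>, or the exponent of x_p would be \<open>u\<close> and that of x_q below
        \<open>v\<close>. In both cases the degree of \<open>b\<close> would be at most
        \<open>\<rho>\<close>, whereas it is \<open>Suc d\<close>.\<close>
      have pos: "lookup b y > 0 \<and> (lookup b p < u \<or> lookup b p > u)"
        using small[OF b] db d sb(2) deg[of b] rho by (cases "lookup b p < u") (auto simp: y_def)
      have ab: "b = a + single y 1"
        using pos by (intro poly_mapping_eqI)
          (auto simp: a_def lookup_add lookup_minus lookup_single when_def)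
      have ap: "lookup a p < u \<longleftrightarrow> lookup b p < u"
        using pos pq(1) by (auto simp: a_def y_def lookup_minus lookup_single when_def)
      have "b = \<sigma> a"
        using ab by (simp add: \<sigma>_def ap y_def)
      moreover have "a \<in> S d"
      proof -
        have "lookup a x \<le> lookup b x" for x
          by (simp add: a_def lookup_minus)
        then have "\<forall>i\<in>J. lookup a (j i) < D i" "lookup a p < u \<or> lookup a q < v"
          using sb ap by (meson le_less_trans)+
        moreover have "monom_deg a = d"
          using ab db by (metis add_Suc_right add_right_cancel monom_deg_add monom_deg_single plus_1_eq_Suc add.commute)
        ultimately show ?thesis
          by (simp add: S_def std)
      qed
      ultimately show "b \<in> \<sigma> ` S d"
        by blast
    qed
    then have "S (Suc d) = \<sigma> ` S d"
      using \<sigma>S by blast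
    then show ?thesis
      using inj by (simp add: card_image)
  qed
  show "card (S d) < card (S (Suc d))" if d: "\<rho> = Suc d"
  proof -
    \<comment> \<open>The extremal monomial is at the top of the box and at the inner corner
      \<open>(u, v - 1)\<close> of the L. For \<open>v = 0\<close> the L degenerates to the strip of
      exponents of x_p below \<open>u\<close>; the extremal pair is then \<open>(u - 1, 0)\<close>,
      with \<open>v - 1\<close> truncated to 0.\<close>
    define w where "w = (if v = 0 then u - 1 else u)"
    define b where "b = (\<Sum>i\<in>J. single (j i) (D i - 1)) + single p w + single q (v - 1)"
    have bp: "lookup b p = w" and bq: "lookup b q = v - 1"
      using jJ pq(1) by (auto simp: b_def lookup_add lookup_sum lookup_single when_def)
    have bj: "lookup b (j i) = D i - 1" if i: "i \<in> J" for i
    proof -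
      have "lookup (\<Sum>i\<in>J. single (j i) (D i - 1)) (j i) = (\<Sum>i'\<in>J. if i' = i then D i' - 1 else 0)"
        unfolding lookup_sum using i jqk(1)
        by (intro sum.cong) (auto simp: lookup_single when_def inj_on_def J_def)
      then show ?thesis
        using i jJ[OF i] fin(1) by (simp add: b_def lookup_add lookup_single when_def)
    qed
    have "monom_deg b = (v - 1) + w + (\<Sum>i\<in>J. D i - 1)"
      unfolding deg bp bq using bj by simp
    then have "monom_deg b = Suc d"
      using d rho pq(2) by (auto simp: w_def split: if_splits)
    moreover have "b \<notin> monom_multiples (\<alpha> ` I)"
      unfolding std bp bq using bj Dpos pq(2) by (auto simp: w_def)
    ultimately have "b \<in> S (Suc d)"
      by (simp add: S_def)
    moreover have "b \<notin> \<sigma> ` S d"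
    proof
      assume "b \<in> \<sigma> ` S d"
      then obtain a where a: "b = \<sigma> a"
        by blast
      then show False
        using \<sigma>p[of a] \<sigma>q[of a] bp bq pq(2) by (auto simp: w_def split: if_splits)
    qed
    ultimately have "\<sigma> ` S d \<subset> S (Suc d)"
      using \<sigma>S by blast
    from psubset_card_mono[OF finS this] show ?thesis
      using inj by (simp add: card_image)
  qed
qed

section \<open>Separators and regularity\<close>

lemma monom_eval_single: "monom_eval v (single x n) = (v $ x) ^ n"
proof -
  have "monom_eval v (single x n) = (\<Prod>i\<in>UNIV. if i = x then (v $ i) ^ n else 1)"
    unfolding monom_eval_def by (intro prod.cong) (auto simp: lookup_single when_def)
  then show ?thesis
    by simp
qed

definition linear_form :: "'k::field ^ 'n::finite \<Rightarrow> ('n, 'k) mpoly" where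
  "linear_form a = (\<Sum>i\<in>UNIV. single (single i 1) (a $ i))"

lemma homogeneous_linear_form: "homogeneous 1 (linear_form a)"
  unfolding linear_form_def by (intro homogeneous_sum homogeneous_single) simp

lemma mpoly_eval_linear_form: "mpoly_eval (linear_form a) v = (\<Sum>i\<in>UNIV. a $ i * v $ i)"
  by (simp add: linear_form_def mpoly_eval_eq eval.extend_sum eval.extend_single monom_eval_single)

lemma mpoly_eval_mult: "mpoly_eval (f * g) v = mpoly_eval f v * mpoly_eval g v"
  by (simp add: mpoly_eval_eq eval.extend_mult)

lemma mpoly_eval_prod:
  "finite A \<Longrightarrow> mpoly_eval (\<Prod>j\<in>A. f j) v = (\<Prod>j\<in>A. mpoly_eval (f j) v)"
proof (induction A rule: finite_induct)
  case empty
  show ?case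
    using eval.extend_single[of v 0 1] by (simp add: mpoly_eval_eq monom_eval_def)
qed (simp add: mpoly_eval_mult)

lemma homogeneous_prod_linear:
  "finite A \<Longrightarrow> (\<And>j. j \<in> A \<Longrightarrow> homogeneous 1 (f j)) \<Longrightarrow> homogeneous (card A) (\<Prod>j\<in>A. f j)"
  by (induction A rule: finite_induct) (use homogeneous_mult in \<open>fastforce+\<close>)

lemma hyperplanes_separator:
  fixes P :: "('k::field ^ 'n::finite) set"
  assumes "X \<subseteq> proj_space" "P \<in> X" "\<And>j. j \<in> {1..d} \<Longrightarrow> hyperplane (H j)"
    and "P \<notin> (\<Union>j\<in>{1..d}. H j)" "X - {P} \<subseteq> (\<Union>j\<in>{1..d}. H j)"
  obtains f v where "homogeneous d (f :: ('n, 'k) mpoly)" "v \<in> P" "mpoly_eval f v \<noteq> 0"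
    "\<forall>p\<in>X - {P}. \<forall>w\<in>p. mpoly_eval f w = 0"
proof -
  have "\<forall>j\<in>{1..d}. \<exists>a. H j = {p \<in> proj_space. \<forall>v\<in>p. (\<Sum>i\<in>UNIV. a $ i * v $ i) = 0}"
    using assms(3) unfolding hyperplane_def by blast
  from bchoice[OF this] obtain A where
    A: "\<And>j. j \<in> {1..d} \<Longrightarrow> H j = {p \<in> proj_space. \<forall>v\<in>p. mpoly_eval (linear_form (A j)) v = 0}"
    unfolding mpoly_eval_linear_form by blast
  have P: "P \<in> proj_space"
    using assms(1,2) by blast
  then obtain v where v: "v \<in> P"
    using proj_space_ex by blast
  define f where "f = (\<Prod>j\<in>{1..d}. linear_form (A j))"
  have ev: "mpoly_eval f w = (\<Prod>j\<in>{1..d}. mpoly_eval (linear_form (A j)) w)" for w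
    by (simp add: f_def mpoly_eval_prod)
  \<comment> \<open>That \<open>P\<close> is not in \<open>H j\<close> only gives some
    representative at which the form is nonzero; homogeneity moves this to \<open>v\<close>.\<close>
  have nonzero: "mpoly_eval (linear_form (A j)) v \<noteq> 0" if j: "j \<in> {1..d}" for j
  proof
    assume "mpoly_eval (linear_form (A j)) v = 0"
    then have "\<forall>w\<in>P. mpoly_eval (linear_form (A j)) w = 0"
      using mpoly_eval_proj[OF P v _ homogeneous_linear_form] by blast
    then have "P \<in> H j"
      using A[OF j] P by simp
    then show False
      using assms(4) j by blast
  qed
  show ?thesis
  proof (rule that[of f v])
    show "homogeneous d f"
      using homogeneous_prod_linear[of "{1..d}" "\<lambda>j. linear_form (A j)"]
      by (simp add: f_def homogeneous_linear_form[simplified])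
    show "v \<in> P"
      by (fact v)
    show "mpoly_eval f v \<noteq> 0"
      using nonzero by (simp add: ev)
    show "\<forall>p\<in>X - {P}. \<forall>w\<in>p. mpoly_eval f w = 0"
    proof (intro ballI)
      fix p w assume pw: "p \<in> X - {P}" "w \<in> p"
      then obtain j where "j \<in> {1..d}" "p \<in> H j"
        using assms(5) pw(1) by blast
      then have "mpoly_eval (linear_form (A j)) w = 0"
        using A pw(2) by blast
      with \<open>j \<in> {1..d}\<close> show "mpoly_eval f w = 0"
        unfolding ev by (intro prod_zero) auto
    qed
  qed
qed

context monomial_initial_ideal
begin

text \<open>Reduction subtracts a vanishing form and so keeps all values on \<open>X\<close>; the
  value at \<open>v\<close> shows that the remainder is not 0 and has a leading monomial.\<close>

lemma standard_separator:
  assumes "homogeneous d f" "P \<in> X" "v \<in> P" "mpoly_eval f v \<noteq> 0"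
    and "\<forall>p\<in>X - {P}. \<forall>w\<in>p. mpoly_eval f w = 0"
  obtains g a where "homogeneous d g" "\<forall>p\<in>X - {P}. \<forall>w\<in>p. mpoly_eval g w = 0"
    "is_lead r g a" "a \<notin> monom_multiples M"
proof -
  obtain h where h: "h \<in> vanishing_forms X d" "keys (f - h) \<inter> monom_multiples M = {}"
    using normal_form[OF assms(1)] by blast
  have ev: "mpoly_eval (f - h) w = mpoly_eval f w" if "p \<in> X" "w \<in> p" for p w
    using h(1) that by (simp add: mpoly_eval_eq eval.extend_diff vanishing_forms_def)
  have "f - h \<noteq> 0"
    using ev[OF assms(2,3)] assms(4) by (auto simp: mpoly_eval_def)
  then obtain a where a: "is_lead r (f - h) a"
    using lead_ex by blast
  show ?thesis
  proof (rule that[OF _ _ a])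
    show "homogeneous d (f - h)"
      using assms(1) h(1) by (auto simp: vanishing_forms_def intro: homogeneous_diff)
    show "\<forall>p\<in>X - {P}. \<forall>w\<in>p. mpoly_eval (f - h) w = 0"
      using ev assms(5) by (metis DiffD1)
    show "a \<notin> monom_multiples M"
      using a h(2) by (auto simp: is_lead_def)
  qed
qed

text \<open>
  Multiplying a separator of \<open>P\<close> by a form vanishing at \<open>P\<close> gives a form in the vanishing ideal,
  and some nonzero combination of any two variables vanishes at \<open>P\<close>.
\<close>

lemma separator_unique_successor:
  assumes "homogeneous d g" "P \<in> X" "\<forall>p\<in>X - {P}. \<forall>w\<in>p. mpoly_eval g w = 0"
    and "is_lead r g a" "x \<noteq> y"
    and "a + single x 1 \<notin> monom_multiples M" "a + single y 1 \<notin> monom_multiples M"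
  shows False
proof -
  have P: "P \<in> proj_space"
    using assms(2) points by blast
  then obtain v where v: "v \<in> P"
    using proj_space_ex by blast
  \<comment> \<open>The pair \<open>(v $ y, - v $ x)\<close> always solves the equation but is zero
    when both coordinates vanish, hence the case split.\<close>
  obtain b c where bc: "b \<noteq> 0 \<or> c \<noteq> 0" "b * v $ x + c * v $ y = 0"
  proof (cases "v $ x = 0")
    case True
    then show ?thesis
      using that[of 1 0] by simp
  next
    case False
    then show ?thesis
      using that[of "v $ y" "- v $ x"] by simp
  qed
  define l :: "('n, 'k) mpoly" where "l = single (single x 1) b + single (single y 1) c"
  have "single x (1::nat) \<noteq> single y 1"
    using assms(5) by (metis keys_single one_neq_zero singleton_inject)
  then have "lookup l (single x 1) = b" "lookup l (single y 1) = c"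
    by (simp_all add: l_def lookup_add lookup_single)
  then have "l \<noteq> 0"
    using bc(1) by auto
  then obtain m where m: "is_lead r l m"
    using lead_ex by blast
  have "keys l \<subseteq> keys (single (single x (1::nat)) b) \<union> keys (single (single y (1::nat)) c)"
    unfolding l_def by (rule Poly_Mapping.keys_add)
  also have "\<dots> \<subseteq> {single x 1, single y 1}"
    by auto
  finally have "m \<in> {single x 1, single y 1}"
    using m by (auto simp: is_lead_def)
  \<comment> \<open>Two standard successors are needed because the order, or a zero coefficient,
    decides which of the two variables leads \<open>l\<close>.\<close>
  then have notin: "m + a \<notin> monom_multiples M"
    using assms(6,7) by (auto simp: add.commute)
  have hom: "homogeneous (1 + d) (l * g)"
    unfolding l_def
    by (intro homogeneous_mult homogeneous_add homogeneous_single assms(1)) simp_all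
  have "mpoly_eval l v = 0"
    using bc(2) by (simp add: l_def mpoly_eval_eq eval.extend_add eval.extend_single monom_eval_single)
  then have "mpoly_eval (l * g) w = 0" if "w \<in> P" for w
    using mpoly_eval_proj[OF P v that hom] by (simp add: mpoly_eval_mult)
  moreover have "mpoly_eval (l * g) w = 0" if "p \<in> X - {P}" "w \<in> p" for p w
    using assms(3) that by (simp add: mpoly_eval_mult)
  ultimately have "l * g \<in> vanishing_forms X (1 + d)"
    using hom unfolding vanishing_forms_def by blast
  then show False
    using lead_vanishing_form lead_mult[OF m assms(4)] notin by blast
qed

end

text \<open>A polynomial that equals \<open>N\<close> at infinitely many naturals is constant, which
  determines the Hilbert polynomial. The value just below \<open>\<rho>\<close> then makes
  \<open>\<rho>\<close> least; for \<open>\<rho> = 0\<close> there is no such value and minimality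
  is trivial.\<close>

lemma regularity_eq:
  fixes J :: "('n::finite, 'k::field) mpoly set"
  assumes const: "\<And>d. d \<ge> \<rho> \<Longrightarrow> hilbert_fun J d = N"
    and jump: "\<And>d. \<rho> = Suc d \<Longrightarrow> hilbert_fun J d \<noteq> N"
  shows "regularity J = \<rho>"
proof -
  have "hilbert_poly J = [:of_nat N:]"
    unfolding hilbert_poly_def
  proof (rule the_equality)
    show "\<exists>n. \<forall>d\<ge>n. of_nat (hilbert_fun J d) = poly [:of_nat N:] (of_nat d)"
      using const by auto
  next
    fix h :: "rat poly"
    assume "\<exists>n. \<forall>d\<ge>n. of_nat (hilbert_fun J d) = poly h (of_nat d)"
    then obtain n where n: "\<And>d. d \<ge> n \<Longrightarrow> of_nat (hilbert_fun J d) = poly h (of_nat d)"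
      by blast
    have "poly (h - [:of_nat N:]) (of_nat d) = 0" if "d \<ge> max n \<rho>" for d
      using n[of d] const[of d] that by simp
    then have "of_nat ` {max n \<rho>..} \<subseteq> {x. poly (h - [:of_nat N:]) x = 0}"
      by blast
    moreover have "infinite ((of_nat :: nat \<Rightarrow> rat) ` {max n \<rho>..})"
      by (subst finite_image_iff) (auto simp: infinite_Ici)
    ultimately have "h - [:of_nat N:] = 0"
      using poly_roots_finite finite_subset by metis
    then show "h = [:of_nat N:]"
      by simp
  qed
  then have "regularity J = (LEAST r. \<forall>d\<ge>r. hilbert_fun J d = N)"
    by (simp add: regularity_def)
  also have "\<dots> = \<rho>"
  proof (rule Least_equality)
    show "\<forall>d\<ge>\<rho>. hilbert_fun J d = N"
      using const by blast
    show "\<rho> \<le> y" if "\<forall>d\<ge>y. hilbert_fun J d = N" for y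
    proof (cases \<rho>)
      case (Suc d)
      then show ?thesis
        using jump[OF Suc] that by (metis not_less_eq_eq)
    qed simp
  qed
  finally show ?thesis .
qed

theorem corollary4p5:
  fixes X :: "(('k::field) ^ ('n::finite)) set set"
    and r :: "('n monom \<times> 'n monom) set"
    and \<alpha> :: "nat \<Rightarrow> 'n monom"
    and dg :: "nat \<Rightarrow> nat"
    and s d :: nat
    and H :: "nat \<Rightarrow> ('k ^ 'n) set set"
    and P :: "('k ^ 'n) set"
  assumes "s = CARD('n)" and "s \<ge> 2"
    and "X \<subseteq> proj_space" and "finite X"
    and "graded_monomial_order r"
    and "complete_intersection (initial_ideal r (vanishing_ideal X))"
    and "initial_ideal r (vanishing_ideal X)
           = ideal.span ((\<lambda>i. Poly_Mapping.single (\<alpha> i) 1) ` {2..s})"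
    and "\<And>i. i \<in> {2..s} \<Longrightarrow> dg i = monom_deg (\<alpha> i)"
    and "\<And>i. i \<in> {2..s} \<Longrightarrow> 1 \<le> dg i"
    and "\<And>i. i \<in> {2..<s} \<Longrightarrow> dg i \<le> dg (Suc i)"
    and "\<And>j. j \<in> {1..d} \<Longrightarrow> hyperplane (H j)"
    and "P \<in> X"
    and "P \<notin> (\<Union>j\<in>{1..d}. H j)"
    and "X - {P} \<subseteq> (\<Union>j\<in>{1..d}. H j)"
  shows "d \<ge> regularity (vanishing_ideal X) \<and>
         regularity (vanishing_ideal X) = (\<Sum>i=2..s. (dg i - 1))"
proof -
  let ?I = "{2..s}"
  let ?\<rho> = "\<Sum>i\<in>?I. monom_deg (\<alpha> i) - 1"
  interpret monomial_initial_ideal X r "\<alpha> ` ?I"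
    using assms(3,4,5,7) by unfold_locales (auto simp: graded_monomial_order_def image_image)
  have I: "finite ?I" "?I \<noteq> {}" "Suc (card ?I) = CARD('n)"
    using assms(1,2) by auto
  have ne: "keys (\<alpha> i) \<noteq> {}" if "i \<in> ?I" for i
    using assms(8,9)[OF that] by (auto simp: monom_deg_keys)
  \<comment> \<open>The bound that does not depend on the degree is \<open>card X\<close>.\<close>
  have disj: "keys (\<alpha> k) \<inter> keys (\<alpha> l) = {}" if "k \<in> ?I" "l \<in> ?I" "k \<noteq> l" for k l
    using disjoint_keys_if_bounded[OF I(1,3) ne card_standard_le[unfolded standard_def] that] .
  have stable: "card (standard (Suc e)) = card (standard e)" if "e \<ge> ?\<rho>" for e
    unfolding standard_def by (rule standard_count(1)[OF I ne disj that])
  have increase: "card (standard e) < card (standard (Suc e))" if "?\<rho> = Suc e" for e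
    unfolding standard_def by (rule standard_count(2)[OF I ne disj that])
  have reg: "regularity (vanishing_ideal X) = ?\<rho>"
  proof (rule regularity_eq)
    show const: "hilbert_fun (vanishing_ideal X) e = card (standard ?\<rho>)" if "e \<ge> ?\<rho>" for e
      unfolding hilbert_fun_standard using that stable by (induction e rule: dec_induct) simp_all
    show "hilbert_fun (vanishing_ideal X) e \<noteq> card (standard ?\<rho>)" if e: "?\<rho> = Suc e" for e
      unfolding hilbert_fun_standard e using increase[OF e] by simp
  qed
  obtain f v where f: "homogeneous d f" "v \<in> P" "mpoly_eval f v \<noteq> 0"
    "\<forall>p\<in>X - {P}. \<forall>w\<in>p. mpoly_eval f w = 0"
    using hyperplanes_separator[OF assms(3,12,11,13,14)] by blast
  obtain g a where g: "homogeneous d g" "\<forall>p\<in>X - {P}. \<forall>w\<in>p. mpoly_eval g w = 0"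
    "is_lead r g a" "a \<notin> monom_multiples (\<alpha> ` ?I)"
    by (rule standard_separator[OF f(1) assms(12) f(2,3,4)])
  have deg: "monom_deg a = d"
    using g(1,3) by (auto simp: is_lead_def homogeneous_def)
  have "?\<rho> \<le> d"
  proof (rule ccontr)
    assume "\<not> ?\<rho> \<le> d"
    then have "monom_deg a < ?\<rho>"
      using deg by simp
    from two_standard_successors[OF I(1,3) disj g(4) this] obtain x y
      where xy: "x \<noteq> y" "a + single x 1 \<notin> monom_multiples (\<alpha> ` ?I)"
        "a + single y 1 \<notin> monom_multiples (\<alpha> ` ?I)"
      by blast
    show False
      by (rule separator_unique_successor[OF g(1) assms(12) g(2,3) xy])
  qed
  then show ?thesis
    using reg assms(8) by simp
qed

end
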